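(* If the random walk $S_n$ is centred and has a finite variance, then the family of distributions $\mathrm{Law}(G_n)_{n\ge1}$ is tight.
   Context: $S_n=X_1+\dots+X_n$ is a random walk on the real line with i.i.d. increments $X_i$; centred means $\mathbb{E}X_1=0$. For each $n$ let $S_{(1,n)}\le S_{(2,n)}\le\dots\le S_{(n,n)}$ be the elements of $S_1,\dots,S_n$ arranged in weakly ascending order. The largest gap by time $n$ is $$G_n=\max_{1\le k\le n-1}\bigl(S_{(k+1,n)}-S_{(k,n)}\bigr)$$ (with $G_1=0$ by convention). *)

theory Defs
  imports "HOL-Probability.Probability"
begin

definition random_walk :: "(nat \<Rightarrow> 'a \<Rightarrow> real) \<Rightarrow> nat \<Rightarrow> 'a \<Rightarrow> real" where
  "random_walk X n \<omega> = (\<Sum>i=1..n. X i \<omega>)"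

text \<open>The \<open>k\<close>-th smallest, counted with multiplicity and starting from \<open>k = 1\<close>, of the
  values \<open>s 1, \<dots>, s n\<close>; only meaningful for \<open>1 \<le> k \<le> n\<close>.\<close>

definition order_stat :: "(nat \<Rightarrow> real) \<Rightarrow> nat \<Rightarrow> nat \<Rightarrow> real" where
  "order_stat s n k = sort (map s [1..<Suc n]) ! (k - 1)"

definition largest_gap :: "(nat \<Rightarrow> real) \<Rightarrow> nat \<Rightarrow> real" where
  "largest_gap s n =
    (if n \<le> 1 then 0 else Max ((\<lambda>k. order_stat s n (k + 1) - order_stat s n k) ` {1..n - 1}))"

definition walk_gap :: "(nat \<Rightarrow> 'a \<Rightarrow> real) \<Rightarrow> nat \<Rightarrow> 'a \<Rightarrow> real" where
  "walk_gap X n \<omega> = largest_gap (\<lambda>k. random_walk X k \<omega>) n"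

end

theory Submission
  imports Defs
begin

text \<open>Suppose that by time \<open>n\<close> there is a gap of length more than \<open>H\<close>, and look at the walk from a time \<open>k\<close> at
  which it visits an endpoint of the gap. The future of the walk and its reversed past are independent walks with
  the same increment law, and both avoid an adjacent interval of length \<open>H\<close>. A centred walk with finite variance avoids
  a suitable bounded interval for \<open>m\<close> steps with a probability of order \<open>1 / sqrt m\<close>. Hence the event at time
  \<open>k\<close> has a probability of order \<open>1 / (sqrt k * sqrt (n - k + 1))\<close>, and the sum over \<open>k\<close> is bounded in \<open>n\<close>
  (\<open>sum_inverse_sqrt_product_le\<close>). So the expected number of large gaps is bounded; what remains is to gain a
  factor that tends to zero with \<open>H\<close>.

  The factor comes from the jump across the gap. Take visits of both endpoints and a
  jump between them. The jump lies in the first half of the time between the visits, counted from one of the two endpoints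
  (\<open>jump_near_endpoint\<close>). Choose that endpoint for the decomposition at time \<open>k\<close>. Then one of
  the two independent walks, say with \<open>m\<close> steps, avoids the interval and moreover jumps across it by at least \<open>H\<close> during the
  first half of its time. After the jump it must still avoid the interval for \<open>m div 2\<close> steps, which has a
  probability of order \<open>1 / sqrt m\<close> times the distance at which the jump lands. So it suffices that
  the expected landing distance, summed over all jumps of size at least \<open>H\<close> across the interval,
  tends to zero with \<open>H\<close> (\<open>lyap_supermartingale\<close> and \<open>cross_decay\<close>).

  Both estimates follow from explicit Lyapunov functions of the distance \<open>u\<close> to the centre of the interval. The
  loss caused by steps over the centre is of the order \<open>E (\<bar>X\<bar> - u)\<^sup>+\<close>, and a
  function whose second derivative is a large negative multiple of this quantity has enough drift to
  pay for it. Its slope is of the order \<open>E X\<^sup>2\<close> restricted to large \<open>\<bar>X\<bar>\<close>. Finiteness of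
  the variance makes the slope finite, and small when only steps of size at least \<open>H\<close> are counted.\<close>

section \<open>Concave functions of the distance to the origin\<close>

definition trunc_sq :: "real \<Rightarrow> real \<Rightarrow> real" where
  "trunc_sq B x = (if \<bar>x\<bar> \<le> B then x\<^sup>2 else 0)"

text \<open>The averages of \<open>cube_cap a\<close> over a random \<open>a\<close> serve as concave Lyapunov functions: the second
  derivative in \<open>u\<close> is \<open>- 6 * max 0 (a - u)\<close>, so for \<open>a = \<bar>Z\<bar>\<close> the average has a curvature proportional to
  \<open>E (\<bar>Z\<bar> - u)\<^sup>+\<close>, which is the quantity that measures how much the walk loses by overshooting the
  origin from a distance \<open>u\<close>. Subtracting the cube from \<open>a ^ 3\<close> leaves a function with
  Lipschitz constant \<open>3 * a\<^sup>2\<close>, so that a finite second moment suffices.\<close>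

definition cube_cap :: "real \<Rightarrow> real \<Rightarrow> real" where
  "cube_cap a u = a ^ 3 - (max 0 (a - u)) ^ 3"

text \<open>A parabola with curvature \<open>-2\<close> on \<open>[0, 2R]\<close>, continued by a constant; it turns the time that
  the walk spends at distances at most \<open>R\<close> into a loss of height.\<close>

definition quad_cap :: "real \<Rightarrow> real \<Rightarrow> real" where
  "quad_cap R u = (2 * R)\<^sup>2 - (max 0 (2 * R - u))\<^sup>2"

text \<open>The one-step estimate behind all drift bounds. While the walk stays on its side of the origin,
  the tangent at \<open>\<bar>y\<bar>\<close> bounds a concave function and the linear term has mean zero. A step across the
  origin violates the tangent bound, but its size exceeds \<open>\<bar>y\<bar>\<close>, and the error is at
  most the overshoot \<open>\<bar>x\<bar> - \<bar>y\<bar>\<close> times twice the Lipschitz constant.\<close>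

lemma reflected_concave:
  fixes f :: "real \<Rightarrow> real"
  assumes B: "0 < B" "B \<le> \<bar>y\<bar>" and d: "0 \<le> d" "d \<le> L" and g: "0 \<le> g"
    and f0: "f 0 = 0"
    and conc: "\<And>v. 0 \<le> v \<Longrightarrow> f v \<le> f \<bar>y\<bar> + d * (v - \<bar>y\<bar>) - g * trunc_sq B (v - \<bar>y\<bar>)"
    and lip: "\<And>v. 0 \<le> v \<Longrightarrow> f v \<le> L * v"
  shows "f \<bar>y + x\<bar> \<le> f \<bar>y\<bar> + d * sgn y * x - g * trunc_sq B x + 2 * L * max 0 (\<bar>x\<bar> - \<bar>y\<bar>)"
proof (cases "0 \<le> sgn y * (y + x)")
  case True
  have ab: "\<bar>y + x\<bar> - \<bar>y\<bar> = sgn y * x"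
    using True B by (cases "y > 0") (auto simp: sgn_if abs_if)
  have "trunc_sq B (sgn y * x) = trunc_sq B x"
    using B by (auto simp: trunc_sq_def sgn_if)
  moreover have "0 \<le> 2 * L * max 0 (\<bar>x\<bar> - \<bar>y\<bar>)" using d by simp
  ultimately show ?thesis
    using conc[of "\<bar>y + x\<bar>"] by (simp add: ab mult.assoc)
next
  case False
  have ab: "\<bar>y + x\<bar> = \<bar>x\<bar> - \<bar>y\<bar>" "sgn y * x = - \<bar>x\<bar>" "\<bar>x\<bar> > \<bar>y\<bar>"
    using False B by (cases "y > 0"; auto simp: sgn_if abs_if split: if_splits)+
  have t: "trunc_sq B x = 0" using ab B by (simp add: trunc_sq_def)
  have "0 \<le> g * trunc_sq B (0 - \<bar>y\<bar>)" using g by (simp add: trunc_sq_def)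
  then have 1: "d * \<bar>y\<bar> \<le> f \<bar>y\<bar>" using conc[of 0] f0 by (simp add: algebra_simps)
  have 2: "f \<bar>y + x\<bar> \<le> L * (\<bar>x\<bar> - \<bar>y\<bar>)" using lip[of "\<bar>y+x\<bar>"] ab by simp
  have 3: "d * (\<bar>x\<bar> - \<bar>y\<bar>) \<le> L * (\<bar>x\<bar> - \<bar>y\<bar>)" using d ab by (intro mult_right_mono) auto
  have "d * sgn y * x = - d * \<bar>x\<bar>" using ab(2) by (simp add: mult.assoc)
  moreover have "max 0 (\<bar>x\<bar> - \<bar>y\<bar>) = \<bar>x\<bar> - \<bar>y\<bar>" using ab by simp
  ultimately show ?thesis using 1 2 3 by (simp only: t) (simp add: algebra_simps)
qed

text \<open>Tangent bounds with a quadratic gain. The gain is claimed only for steps of size at most \<open>B\<close>, so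
  the curvature of the parabola on the whole of \<open>[t - B, t + B]\<close> is at least what appears on
  the right-hand side.\<close>

lemma sq_pos_part_tangent:
  fixes t d B :: real
  assumes "0 \<le> B"
  shows "(max 0 t)\<^sup>2 - (max 0 (t - d))\<^sup>2 \<le> 2 * max 0 t * d - (if B \<le> t then trunc_sq B d else 0)"
proof -
  have sq: "0 \<le> (t - d)\<^sup>2" "0 \<le> d\<^sup>2" by simp_all
  have e: "t\<^sup>2 - (t - d)\<^sup>2 = 2 * t * d - d\<^sup>2" by (simp add: power2_eq_square algebra_simps)
  have k: "trunc_sq B d = 0" if "\<not> \<bar>d\<bar> \<le> B" using that by (simp add: trunc_sq_def)
  have l: "t * t \<le> t * d" if "0 \<le> t" "t \<le> d" using that by (rule mult_left_mono[rotated])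
  consider "t \<le> 0" | "0 \<le> t" "t \<le> d" | "0 \<le> t" "d \<le> t" by linarith
  then show ?thesis
  proof cases
    case 1
    then show ?thesis using assms by (auto simp: max_def trunc_sq_def)
  next
    case 2
    have "t\<^sup>2 \<le> 2 * t * d - (if B \<le> t then trunc_sq B d else 0)"
    proof (cases "B \<le> t \<and> \<bar>d\<bar> \<le> B")
      case True
      then have "d = t" using 2 by linarith
      then show ?thesis using True by (simp add: trunc_sq_def power2_eq_square)
    next
      case False
      then have "(if B \<le> t then trunc_sq B d else 0) = 0" by (auto simp: trunc_sq_def)
      moreover have "0 \<le> t * t" by simp
      ultimately show ?thesis using l[OF 2] by (simp only: power2_eq_square)
    qed
    moreover have "max 0 t = t" "max 0 (t - d) = 0" using 2 by auto
    ultimately show ?thesis by simp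
  next
    case 3
    then show ?thesis using e sq by (auto simp: max_def trunc_sq_def)
  qed
qed

text \<open>For the cube the curvature decreases to zero at the cap, which is why the gain carries the
  factor \<open>t - B\<close> of the worst point of \<open>[t - B, t + B]\<close> instead of \<open>t\<close>.\<close>

lemma cube_pos_part_tangent:
  fixes t d B :: real
  assumes "0 \<le> B"
  shows "(max 0 t) ^ 3 - (max 0 (t - d)) ^ 3 \<le> 3 * (max 0 t)\<^sup>2 * d - 3 * max 0 (t - B) * trunc_sq B d"
proof -
  have convex: "s ^ 3 - r ^ 3 \<le> 3 * s\<^sup>2 * (s - r)" if "0 \<le> s" "0 \<le> r" for s r :: real
  proof -
    \<comment> \<open>The tangent to the cube at \<open>s\<close> lies below its graph on the half line.\<close>
    have "3 * s\<^sup>2 * (s - r) - (s ^ 3 - r ^ 3) = (s - r)\<^sup>2 * (2 * s + r)"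
      by (simp add: power2_eq_square power3_eq_cube algebra_simps)
    then show ?thesis using that by (metis add_nonneg_nonneg diff_ge_0_iff_ge mult_nonneg_nonneg zero_le_numeral zero_le_power2)
  qed
  show ?thesis
  proof (cases "B < t \<and> \<bar>d\<bar> \<le> B")
    case True
    then have "0 \<le> d\<^sup>2 * (3 * B - d)" using assms by (intro mult_nonneg_nonneg) auto
    then have "t ^ 3 - (t - d) ^ 3 \<le> 3 * t\<^sup>2 * d - 3 * (t - B) * d\<^sup>2"
      by (simp add: power2_eq_square power3_eq_cube algebra_simps)
    moreover have "max 0 t = t" "max 0 (t - d) = t - d" "max 0 (t - B) = t - B" "trunc_sq B d = d\<^sup>2"
      using True assms by (auto simp: trunc_sq_def)
    ultimately show ?thesis by simp
  next
    case False
    then have z: "3 * max 0 (t - B) * trunc_sq B d = 0" by (auto simp: trunc_sq_def)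
    have "(max 0 t) ^ 3 - (max 0 (t - d)) ^ 3 \<le> 3 * (max 0 t)\<^sup>2 * (max 0 t - max 0 (t - d))"
      by (rule convex) auto
    also have "\<dots> \<le> 3 * (max 0 t)\<^sup>2 * d"
    proof (cases "0 \<le> t")
      case True
      then show ?thesis by (intro mult_left_mono) auto
    qed (simp add: max_def)
    finally show ?thesis unfolding z by simp
  qed
qed

lemma cube_cap_lipschitz:
  assumes "0 \<le> a" "0 \<le> u" shows "0 \<le> cube_cap a u" "cube_cap a u \<le> 3 * a\<^sup>2 * u"
proof -
  have "(max 0 (a - u)) ^ 3 \<le> a ^ 3" using assms by (intro power_mono) auto
  then show "0 \<le> cube_cap a u" by (simp add: cube_cap_def)
  have "0 \<le> 3 * max 0 (a - 0) * trunc_sq 0 u" using assms by (simp add: trunc_sq_def)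
  then show "cube_cap a u \<le> 3 * a\<^sup>2 * u"
    using cube_pos_part_tangent[of 0 a u] assms by (simp add: cube_cap_def)
qed

lemma quad_cap_lipschitz:
  assumes "0 \<le> R" "0 \<le> u" shows "0 \<le> quad_cap R u" "quad_cap R u \<le> 4 * R * u"
proof -
  have "(max 0 (2 * R - u))\<^sup>2 \<le> (2 * R)\<^sup>2" using assms by (intro power_mono) auto
  then show "0 \<le> quad_cap R u" by (simp add: quad_cap_def)
  have "0 \<le> (if 0 \<le> 2 * R then trunc_sq 0 u else 0)" using assms by (simp add: trunc_sq_def)
  then show "quad_cap R u \<le> 4 * R * u"
    using sq_pos_part_tangent[of 0 "2 * R" u] assms by (simp add: quad_cap_def)
qed

lemma cube_cap_reflected:
  assumes "0 < B" "B \<le> \<bar>y\<bar>" "0 \<le> a"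
  shows "cube_cap a \<bar>y + x\<bar> \<le> cube_cap a \<bar>y\<bar> + 3 * (max 0 (a - \<bar>y\<bar>))\<^sup>2 * sgn y * x
      - 3 * max 0 (a - B - \<bar>y\<bar>) * trunc_sq B x + 2 * (3 * a\<^sup>2) * max 0 (\<bar>x\<bar> - \<bar>y\<bar>)"
proof (rule reflected_concave)
  show "3 * (max 0 (a - \<bar>y\<bar>))\<^sup>2 \<le> 3 * a\<^sup>2" using assms by (auto intro!: power_mono)
next
  fix v :: real assume "0 \<le> v"
  show "cube_cap a v \<le> cube_cap a \<bar>y\<bar> + 3 * (max 0 (a - \<bar>y\<bar>))\<^sup>2 * (v - \<bar>y\<bar>)
      - 3 * max 0 (a - B - \<bar>y\<bar>) * trunc_sq B (v - \<bar>y\<bar>)"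
    using cube_pos_part_tangent[of B "a - \<bar>y\<bar>" "v - \<bar>y\<bar>"] assms
    by (simp add: cube_cap_def algebra_simps)
qed (use assms cube_cap_lipschitz in \<open>auto simp: cube_cap_def\<close>)

lemma quad_cap_reflected:
  assumes "0 < B" "B \<le> \<bar>y\<bar>" "B \<le> R"
  shows "quad_cap R \<bar>y + x\<bar> \<le> quad_cap R \<bar>y\<bar> + 2 * max 0 (2 * R - \<bar>y\<bar>) * sgn y * x
      - of_bool (\<bar>y\<bar> \<le> R) * trunc_sq B x + 2 * (4 * R) * max 0 (\<bar>x\<bar> - \<bar>y\<bar>)"
proof (rule reflected_concave)
  fix v :: real assume "0 \<le> v"
  have "of_bool (\<bar>y\<bar> \<le> R) * trunc_sq B (v - \<bar>y\<bar>)
      \<le> (if B \<le> 2 * R - \<bar>y\<bar> then trunc_sq B (v - \<bar>y\<bar>) else 0)"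
    using assms by (auto simp: trunc_sq_def)
  then show "quad_cap R v \<le> quad_cap R \<bar>y\<bar> + 2 * max 0 (2 * R - \<bar>y\<bar>) * (v - \<bar>y\<bar>)
      - of_bool (\<bar>y\<bar> \<le> R) * trunc_sq B (v - \<bar>y\<bar>)"
    using sq_pos_part_tangent[of B "2 * R - \<bar>y\<bar>" "v - \<bar>y\<bar>"] assms
    by (simp add: quad_cap_def algebra_simps)
qed (use assms quad_cap_lipschitz in \<open>auto simp: quad_cap_def\<close>)

lemma abs_reflected:
  assumes "0 < B" "B \<le> \<bar>y\<bar>"
  shows "\<bar>y + x\<bar> \<le> \<bar>y\<bar> + 1 * sgn y * x - 0 * trunc_sq B x + 2 * 1 * max 0 (\<bar>x\<bar> - \<bar>y\<bar>)"
  by (rule reflected_concave[where f = "\<lambda>u. u"]) (use assms in auto)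

section \<open>Drift of the walk outside a bounded interval\<close>

locale centred_law = prob_space \<mu> for \<mu> :: "real measure" +
  assumes sets_law [measurable_cong]: "sets \<mu> = sets borel"
    and square_integrable: "integrable \<mu> (\<lambda>x. x\<^sup>2)"
    and mean_zero: "(\<integral>x. x \<partial>\<mu>) = 0"
    and variance_pos: "0 < (\<integral>x. x\<^sup>2 \<partial>\<mu>)"
begin

lemma integrable_abs: "integrable \<mu> (\<lambda>x. \<bar>x\<bar>)"
proof (rule Bochner_Integration.integrable_bound)
  show "integrable \<mu> (\<lambda>x. 1 + x\<^sup>2)" using square_integrable by simp
  have "\<bar>x\<bar> \<le> 1 + x\<^sup>2" for x :: real
    using zero_le_power2[of "\<bar>x\<bar> - 1"] zero_le_power2[of x] by (simp add: power2_diff)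
  then show "AE x in \<mu>. norm \<bar>x\<bar> \<le> norm (1 + x\<^sup>2)" by auto
qed simp

lemma integrable_id: "integrable \<mu> (\<lambda>x. x)"
  using integrable_abs by (rule Bochner_Integration.integrable_bound) auto

lemma integrable_trunc_sq: "integrable \<mu> (trunc_sq b)"
  using square_integrable
  by (rule Bochner_Integration.integrable_bound) (auto simp: trunc_sq_def[abs_def])

lemma trunc_sq_limit: "(\<lambda>n. \<integral>x. trunc_sq (real n) x \<partial>\<mu>) \<longlonglongrightarrow> (\<integral>x. x\<^sup>2 \<partial>\<mu>)"
proof (rule integral_dominated_convergence[where w = "\<lambda>x. x\<^sup>2"])
  show "AE x in \<mu>. (\<lambda>n. trunc_sq (real n) x) \<longlonglongrightarrow> x\<^sup>2"
  proof (rule AE_I2)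
    fix x :: real
    obtain n0 where "\<bar>x\<bar> \<le> real n0" using real_arch_simple by blast
    then have "eventually (\<lambda>n. trunc_sq (real n) x = x\<^sup>2) sequentially"
      by (intro eventually_sequentiallyI[of n0]) (auto simp: trunc_sq_def)
    then show "(\<lambda>n. trunc_sq (real n) x) \<longlonglongrightarrow> x\<^sup>2"
      by (rule tendsto_eventually)
  qed
qed (use square_integrable in \<open>auto simp: trunc_sq_def[abs_def]\<close>)

text \<open>The random cap that is put into \<open>cube_cap\<close>. Padding by \<open>b\<close> compensates the shift by \<open>B\<close> in
  \<open>cube_pos_part_tangent\<close>, and cutting at \<open>H\<close> makes the resulting Lyapunov function small for large
  \<open>H\<close> while it still sees all jumps of size at least \<open>H\<close>.\<close>

definition padded_tail :: "real \<Rightarrow> real \<Rightarrow> real \<Rightarrow> real" where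
  "padded_tail b H z = (if H \<le> \<bar>z\<bar> then \<bar>z\<bar> + b else 0)"

text \<open>The Lipschitz constant of the averaged caps. It tends to zero as \<open>H\<close> grows, and this is where the
  smallness of the probability of large gaps comes from.\<close>

definition tail_moment :: "real \<Rightarrow> real \<Rightarrow> real" where
  "tail_moment b H = 3 * (\<integral>z. (padded_tail b H z)\<^sup>2 \<partial>\<mu>)"

lemma padded_tail_sq_le: "(padded_tail b H z)\<^sup>2 \<le> 2 * z\<^sup>2 + 2 * b\<^sup>2"
  using zero_le_power2[of "\<bar>z\<bar> - b"] zero_le_power2[of z] zero_le_power2[of b]
  by (auto simp: padded_tail_def power2_sum power2_diff)

lemma integrable_padded_tail_sq: "integrable \<mu> (\<lambda>z. (padded_tail b H z)\<^sup>2)"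
proof (rule Bochner_Integration.integrable_bound)
  show "integrable \<mu> (\<lambda>z. 2 * z\<^sup>2 + 2 * b\<^sup>2)" using square_integrable by simp
  show "AE z in \<mu>. norm ((padded_tail b H z)\<^sup>2) \<le> norm (2 * z\<^sup>2 + 2 * b\<^sup>2)"
    using padded_tail_sq_le[of b H] by auto
qed (simp add: padded_tail_def[abs_def])

lemma tail_moment_nonneg: "0 \<le> tail_moment b H"
  by (simp add: tail_moment_def)

lemma tail_moment_limit: "(\<lambda>n. tail_moment b (real n)) \<longlonglongrightarrow> 0"
proof -
  have "(\<lambda>n. \<integral>z. (padded_tail b (real n) z)\<^sup>2 \<partial>\<mu>) \<longlonglongrightarrow> (\<integral>z. 0 \<partial>\<mu>)"
  proof (rule integral_dominated_convergence[where w = "\<lambda>z. 2 * z\<^sup>2 + 2 * b\<^sup>2"])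
    show "AE z in \<mu>. (\<lambda>n. (padded_tail b (real n) z)\<^sup>2) \<longlonglongrightarrow> 0"
    proof (rule AE_I2)
      fix z :: real
      obtain n0 where "\<bar>z\<bar> < real n0" using reals_Archimedean2 by blast
      then have "eventually (\<lambda>n. (padded_tail b (real n) z)\<^sup>2 = 0) sequentially"
        by (intro eventually_sequentiallyI[of n0]) (auto simp: padded_tail_def)
      then show "(\<lambda>n. (padded_tail b (real n) z)\<^sup>2) \<longlonglongrightarrow> 0"
        by (rule tendsto_eventually)
    qed
    show "AE z in \<mu>. norm ((padded_tail b (real n) z)\<^sup>2) \<le> 2 * z\<^sup>2 + 2 * b\<^sup>2" for n
      using padded_tail_sq_le[of b "real n"] by auto
  qed (use square_integrable in \<open>auto simp: padded_tail_def[abs_def]\<close>)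
  then show ?thesis
    unfolding tail_moment_def using tendsto_mult_left[of _ 0 sequentially 3] by simp
qed

text \<open>First a level \<open>b\<close> such that increments of size at most \<open>b\<close> carry some variance, then a half width
  \<open>K\<close> so large that the tail beyond \<open>K\<close> is dominated by that variance.\<close>

lemma obtain_scales:
  obtains b K where "0 < b" "b \<le> K" "0 < (\<integral>x. trunc_sq b x \<partial>\<mu>)"
    "tail_moment b K \<le> (\<integral>x. trunc_sq b x \<partial>\<mu>)"
proof -
  have "eventually (\<lambda>n. 0 < (\<integral>x. trunc_sq (real n) x \<partial>\<mu>)) sequentially"
    using trunc_sq_limit variance_pos by (rule order_tendstoD(1))
  moreover have "eventually (\<lambda>n::nat. n > 0) sequentially" by (rule eventually_gt_at_top)
  ultimately have "eventually (\<lambda>n. 0 < (\<integral>x. trunc_sq (real n) x \<partial>\<mu>) \<and> n > 0) sequentially"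
    by (rule eventually_conj)
  then obtain n where n: "0 < (\<integral>x. trunc_sq (real n) x \<partial>\<mu>)" "n > 0"
    by (auto simp: eventually_sequentially)
  have "eventually (\<lambda>k. tail_moment (real n) (real k) < (\<integral>x. trunc_sq (real n) x \<partial>\<mu>)) sequentially"
    using tail_moment_limit n(1) by (rule order_tendstoD(2))
  moreover have "eventually (\<lambda>k. k \<ge> n) sequentially" by (rule eventually_ge_at_top)
  ultimately have "eventually (\<lambda>k. tail_moment (real n) (real k) < (\<integral>x. trunc_sq (real n) x \<partial>\<mu>)
      \<and> k \<ge> n) sequentially" by (rule eventually_conj)
  then obtain k where "tail_moment (real n) (real k) < (\<integral>x. trunc_sq (real n) x \<partial>\<mu>)" "k \<ge> n"
    by (auto simp: eventually_sequentially)
  with n show ?thesis by (intro that[of "real n" "real k"]) auto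
qed

end

text \<open>\<open>K\<close> is the half width of the open interval around the origin that the walk has to avoid, and \<open>b\<close> is the
  size up to which steps are counted as contributing to the quadratic gain.\<close>

locale avoiding_walk = centred_law +
  fixes b K :: real
  assumes b_pos: "0 < b" and b_le_K: "b \<le> K"
    and core_variance_pos: "0 < (\<integral>x. trunc_sq b x \<partial>\<mu>)"
    and tail_moment_le: "tail_moment b K \<le> (\<integral>x. trunc_sq b x \<partial>\<mu>)"
begin

definition core_variance :: real where
  "core_variance = (\<integral>x. trunc_sq b x \<partial>\<mu>)"

definition tail_excess :: "real \<Rightarrow> real \<Rightarrow> real" where
  "tail_excess H u = (\<integral>z. (if H \<le> \<bar>z\<bar> then max 0 (\<bar>z\<bar> - u) else 0) \<partial>\<mu>)"

definition lyap :: "real \<Rightarrow> real \<Rightarrow> real" where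
  "lyap H u = (\<integral>z. cube_cap (padded_tail b H z) u \<partial>\<mu>)"

lemma K_pos: "0 < K" using b_pos b_le_K by simp

lemma cv_pos: "0 < core_variance" using core_variance_pos by (simp add: core_variance_def)

lemma padded_tail_nonneg: "0 \<le> padded_tail b H z"
  using b_pos by (simp add: padded_tail_def)

lemma integrable_excess:
  "0 \<le> u \<Longrightarrow> integrable \<mu> (\<lambda>z. if H \<le> \<bar>z\<bar> then max 0 (\<bar>z\<bar> - u) else 0)"
  using integrable_abs by (rule Bochner_Integration.integrable_bound) auto

lemma tail_excess_nonneg: "0 \<le> tail_excess H u"
  unfolding tail_excess_def by (rule integral_nonneg_AE) auto

lemma integrable_cube_cap:
  assumes "0 \<le> u" shows "integrable \<mu> (\<lambda>z. cube_cap (padded_tail b H z) u)"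
proof (rule Bochner_Integration.integrable_bound)
  show "integrable \<mu> (\<lambda>z. 3 * (padded_tail b H z)\<^sup>2 * u)"
    using integrable_padded_tail_sq by simp
  show "AE z in \<mu>. norm (cube_cap (padded_tail b H z) u) \<le> norm (3 * (padded_tail b H z)\<^sup>2 * u)"
    using cube_cap_lipschitz[OF padded_tail_nonneg assms] assms by (intro AE_I2) (auto simp: abs_mult)
qed (simp add: cube_cap_def[abs_def] padded_tail_def[abs_def])

lemma lyap_lipschitz:
  assumes "0 \<le> u" shows "0 \<le> lyap H u" "lyap H u \<le> tail_moment b H * u"
proof -
  show "0 \<le> lyap H u" unfolding lyap_def
    using cube_cap_lipschitz(1)[OF padded_tail_nonneg assms] by (intro integral_nonneg_AE) auto
  have "lyap H u \<le> (\<integral>z. 3 * (padded_tail b H z)\<^sup>2 * u \<partial>\<mu>)" unfolding lyap_def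
    using cube_cap_lipschitz(2)[OF padded_tail_nonneg assms] integrable_padded_tail_sq
    by (intro integral_mono integrable_cube_cap assms) auto
  then show "lyap H u \<le> tail_moment b H * u" by (simp add: tail_moment_def)
qed

text \<open>The estimate of \<open>cube_cap_reflected\<close> averaged over the cap. Its gain is the tail excess
  itself.\<close>

lemma lyap_reflected:
  assumes "b \<le> \<bar>y\<bar>"
  obtains c where "\<And>x. lyap H \<bar>y + x\<bar> \<le> lyap H \<bar>y\<bar> + c * x
      - 3 * tail_excess H \<bar>y\<bar> * trunc_sq b x + 2 * tail_moment b H * max 0 (\<bar>x\<bar> - \<bar>y\<bar>)"
proof
  let ?A = "padded_tail b H"
  let ?c = "(\<integral>z. 3 * (max 0 (?A z - \<bar>y\<bar>))\<^sup>2 \<partial>\<mu>) * sgn y"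
  fix x
  have i1: "integrable \<mu> (\<lambda>z. (max 0 (?A z - \<bar>y\<bar>))\<^sup>2)"
  proof (rule Bochner_Integration.integrable_bound[OF integrable_padded_tail_sq[of b H]])
    show "AE z in \<mu>. norm ((max 0 (?A z - \<bar>y\<bar>))\<^sup>2) \<le> norm ((?A z)\<^sup>2)"
      using padded_tail_nonneg by (intro AE_I2) (auto intro!: power_mono)
  qed (simp add: padded_tail_def[abs_def])
  \<comment> \<open>Below \<open>H\<close> the cap vanishes and both sides are zero; above \<open>H\<close> the padding cancels.\<close>
  have ex: "max 0 (?A z - b - \<bar>y\<bar>) = (if H \<le> \<bar>z\<bar> then max 0 (\<bar>z\<bar> - \<bar>y\<bar>) else 0)" for z
    using b_pos by (simp add: padded_tail_def)
  note ie = integrable_excess[of "\<bar>y\<bar>" H]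
  have "lyap H \<bar>y + x\<bar> \<le> (\<integral>z. cube_cap (?A z) \<bar>y\<bar> + 3 * (max 0 (?A z - \<bar>y\<bar>))\<^sup>2 * sgn y * x
      - 3 * (if H \<le> \<bar>z\<bar> then max 0 (\<bar>z\<bar> - \<bar>y\<bar>) else 0) * trunc_sq b x
      + 2 * (3 * (?A z)\<^sup>2) * max 0 (\<bar>x\<bar> - \<bar>y\<bar>) \<partial>\<mu>)"
    unfolding lyap_def
  proof (rule integral_mono)
    show "integrable \<mu> (\<lambda>z. cube_cap (?A z) \<bar>y\<bar> + 3 * (max 0 (?A z - \<bar>y\<bar>))\<^sup>2 * sgn y * x
      - 3 * (if H \<le> \<bar>z\<bar> then max 0 (\<bar>z\<bar> - \<bar>y\<bar>) else 0) * trunc_sq b x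
      + 2 * (3 * (?A z)\<^sup>2) * max 0 (\<bar>x\<bar> - \<bar>y\<bar>))"
      by (intro Bochner_Integration.integrable_add Bochner_Integration.integrable_diff
          integrable_mult_left integrable_mult_right integrable_cube_cap i1 ie
          integrable_padded_tail_sq) auto
  next
    fix z
    show "cube_cap (?A z) \<bar>y + x\<bar> \<le> cube_cap (?A z) \<bar>y\<bar> + 3 * (max 0 (?A z - \<bar>y\<bar>))\<^sup>2 * sgn y * x
      - 3 * (if H \<le> \<bar>z\<bar> then max 0 (\<bar>z\<bar> - \<bar>y\<bar>) else 0) * trunc_sq b x
      + 2 * (3 * (?A z)\<^sup>2) * max 0 (\<bar>x\<bar> - \<bar>y\<bar>)"
      using cube_cap_reflected[OF b_pos assms padded_tail_nonneg, of H z x] by (simp only: ex)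
  qed (simp add: integrable_cube_cap)
  also have "\<dots> = lyap H \<bar>y\<bar> + (\<integral>z. 3 * (max 0 (?A z - \<bar>y\<bar>))\<^sup>2 * sgn y * x \<partial>\<mu>)
      - (\<integral>z. 3 * (if H \<le> \<bar>z\<bar> then max 0 (\<bar>z\<bar> - \<bar>y\<bar>) else 0) * trunc_sq b x \<partial>\<mu>)
      + (\<integral>z. 2 * (3 * (?A z)\<^sup>2) * max 0 (\<bar>x\<bar> - \<bar>y\<bar>) \<partial>\<mu>)"
    unfolding lyap_def
    by (subst Bochner_Integration.integral_add Bochner_Integration.integral_diff,
        (intro Bochner_Integration.integrable_add Bochner_Integration.integrable_diff
          integrable_mult_left integrable_mult_right integrable_cube_cap i1 ie
          integrable_padded_tail_sq; simp)+)+ simp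
  also have "\<dots> = lyap H \<bar>y\<bar> + ?c * x
      - 3 * tail_excess H \<bar>y\<bar> * trunc_sq b x + 2 * tail_moment b H * max 0 (\<bar>x\<bar> - \<bar>y\<bar>)"
    by (simp only: tail_excess_def tail_moment_def integral_mult_left_zero integral_mult_right_zero)
  finally show "lyap H \<bar>y + x\<bar> \<le> lyap H \<bar>y\<bar> + ?c * x
      - 3 * tail_excess H \<bar>y\<bar> * trunc_sq b x + 2 * tail_moment b H * max 0 (\<bar>x\<bar> - \<bar>y\<bar>)" .
qed

text \<open>The pointwise bound is an integrable function of the step whose linear term has mean zero. Later
  the integrand also contains a reward \<open>e\<close> for a jump and a rate \<open>k\<close> that depends on the remaining time; keeping both
  under the integral avoids splitting it.\<close>

lemma expected_dominated:
  assumes dom: "\<And>x. F (y + x) \<le> F y + c * x - g * trunc_sq b x + l * max 0 (\<bar>x\<bar> - \<bar>y\<bar>)"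
    and e: "integrable \<mu> e" and nonneg: "\<And>x. 0 \<le> F x" "\<And>x. 0 \<le> e x" and k: "0 \<le> k"
  shows "(\<integral>\<^sup>+x. ennreal (k * (F (y + x) + e x)) \<partial>\<mu>)
    \<le> ennreal (k * (F y - g * core_variance + l * tail_excess 0 \<bar>y\<bar> + (\<integral>x. e x \<partial>\<mu>)))"
    (is "_ \<le> ennreal (k * ?r)")
proof -
  let ?G = "\<lambda>x. F y + c * x - g * trunc_sq b x + l * max 0 (\<bar>x\<bar> - \<bar>y\<bar>) + e x"
  have ie: "integrable \<mu> (\<lambda>z. max 0 (\<bar>z\<bar> - \<bar>y\<bar>))"
    using integrable_excess[of "\<bar>y\<bar>" 0] by simp
  have G: "has_bochner_integral \<mu> ?G (F y + c * 0 - g * core_variance + l * tail_excess 0 \<bar>y\<bar> + (\<integral>x. e x \<partial>\<mu>))"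
  proof (intro has_bochner_integral_add has_bochner_integral_diff has_bochner_integral_mult_right)
    show "has_bochner_integral \<mu> (\<lambda>x. F y) (F y)"
      by (simp add: has_bochner_integral_iff prob_space)
  qed (use ie e integrable_id integrable_trunc_sq mean_zero in
        \<open>auto simp: has_bochner_integral_iff core_variance_def tail_excess_def\<close>)
  have "(\<integral>\<^sup>+x. ennreal (k * (F (y + x) + e x)) \<partial>\<mu>) \<le> (\<integral>\<^sup>+x. ennreal (k * ?G x) \<partial>\<mu>)"
    using dom k by (intro nn_integral_mono ennreal_leI mult_left_mono) (auto intro: add_right_mono)
  also have "\<dots> = ennreal (\<integral>x. k * ?G x \<partial>\<mu>)"
  proof (rule nn_integral_eq_integral)
    show "integrable \<mu> (\<lambda>x. k * ?G x)"
      using G by (intro integrable_mult_right) (simp add: has_bochner_integral_iff)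
    show "AE x in \<mu>. 0 \<le> k * ?G x"
      using dom nonneg k by (intro AE_I2) (meson add_nonneg_nonneg mult_nonneg_nonneg order_trans)
  qed
  also have "(\<integral>x. k * ?G x \<partial>\<mu>) = k * ?r"
    using has_bochner_integral_mult_right[of k, OF _] G by (simp only: integral_mult_right_zero) (simp add: has_bochner_integral_iff)
  finally show ?thesis .
qed

lemma tail_excess_far: "K \<le> \<bar>y\<bar> \<Longrightarrow> tail_excess K \<bar>y\<bar> = tail_excess 0 \<bar>y\<bar>"
  unfolding tail_excess_def by (intro Bochner_Integration.integral_cong) auto

text \<open>The cap cut at \<open>H\<close> gains \<open>3 * core_variance\<close> times the tail excess above \<open>H\<close>, but it loses, through overshoots,
  a multiple of the full tail excess. A small multiple of the Lyapunov function cut at \<open>K\<close>, whose drift is at most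
  \<open>- core_variance * tail_excess 0 \<bar>y\<bar>\<close> by the choice of \<open>K\<close>, repairs this loss. The sum \<open>W\<close> pays for
  all future jumps of size at least \<open>H\<close> across the interval, weighted by the distance at which they land.\<close>

lemma lyap_supermartingale:
  assumes "K \<le> H"
  obtains W where "\<And>y. 0 \<le> W y" "\<And>y. W y \<le> (1 / core_variance) * tail_moment b H * \<bar>y\<bar>"
    "\<And>y e k. K \<le> \<bar>y\<bar> \<Longrightarrow> integrable \<mu> e \<Longrightarrow> (\<And>x. 0 \<le> e x) \<Longrightarrow> 0 \<le> k \<Longrightarrow>
      (\<integral>\<^sup>+x. ennreal (k * (W (y + x) + e x)) \<partial>\<mu>)
        \<le> ennreal (k * (W y - tail_excess H \<bar>y\<bar> + (\<integral>x. e x \<partial>\<mu>)))"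
proof
  let ?v = core_variance
  \<comment> \<open>The multiple for which the gain at level \<open>K\<close> cancels the overshoot loss at level \<open>H\<close>.\<close>
  let ?m = "2 * tail_moment b H / (3 * ?v\<^sup>2)"
  let ?W = "\<lambda>y. lyap H \<bar>y\<bar> / (3 * ?v) + ?m * lyap K \<bar>y\<bar>"
  have mn: "0 \<le> ?m" using tail_moment_nonneg by simp
  show "0 \<le> ?W y" for y
    using lyap_lipschitz(1)[of "\<bar>y\<bar>"] cv_pos tail_moment_nonneg by simp
  show "?W y \<le> (1 / ?v) * tail_moment b H * \<bar>y\<bar>" for y
  proof -
    have "lyap H \<bar>y\<bar> / (3 * ?v) \<le> tail_moment b H * \<bar>y\<bar> / (3 * ?v)"
      using lyap_lipschitz(2)[of "\<bar>y\<bar>" H] cv_pos by (intro divide_right_mono) auto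
    moreover have "lyap K \<bar>y\<bar> \<le> ?v * \<bar>y\<bar>"
      using lyap_lipschitz(2)[of "\<bar>y\<bar>" K] mult_right_mono[OF tail_moment_le, of "\<bar>y\<bar>"]
      by (simp add: core_variance_def)
    then have "?m * lyap K \<bar>y\<bar> \<le> ?m * (?v * \<bar>y\<bar>)" using mn by (rule mult_left_mono)
    moreover have "?m * (?v * \<bar>y\<bar>) = 2 * (tail_moment b H * \<bar>y\<bar> / (3 * ?v))"
      using cv_pos by (simp add: power2_eq_square)
    moreover have "3 * (tail_moment b H * \<bar>y\<bar> / (3 * ?v)) = (1 / ?v) * tail_moment b H * \<bar>y\<bar>"
      by simp
    ultimately show ?thesis by linarith
  qed
  fix y k :: real and e :: "real \<Rightarrow> real"
  assume y: "K \<le> \<bar>y\<bar>" and e: "integrable \<mu> e" "\<And>x. 0 \<le> e x" and k: "0 \<le> k"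
  have by': "b \<le> \<bar>y\<bar>" using y b_le_K by simp
  obtain c1 where c1: "\<And>x. lyap H \<bar>y + x\<bar> \<le> lyap H \<bar>y\<bar> + c1 * x
      - 3 * tail_excess H \<bar>y\<bar> * trunc_sq b x + 2 * tail_moment b H * max 0 (\<bar>x\<bar> - \<bar>y\<bar>)"
    using lyap_reflected[OF by'] by blast
  obtain c2 where c2: "\<And>x. lyap K \<bar>y + x\<bar> \<le> lyap K \<bar>y\<bar> + c2 * x
      - 3 * tail_excess K \<bar>y\<bar> * trunc_sq b x + 2 * tail_moment b K * max 0 (\<bar>x\<bar> - \<bar>y\<bar>)"
    using lyap_reflected[OF by'] by blast
  let ?h = "tail_excess H \<bar>y\<bar>" and ?hz = "tail_excess 0 \<bar>y\<bar>"
  let ?g = "?h / ?v + ?m * (3 * ?hz)"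
  let ?l = "2 * tail_moment b H / (3 * ?v) + ?m * (2 * tail_moment b K)"
  have dom: "?W (y + x) \<le> ?W y + (c1 / (3 * ?v) + ?m * c2) * x - ?g * trunc_sq b x + ?l * max 0 (\<bar>x\<bar> - \<bar>y\<bar>)" for x
  proof -
    have "lyap H \<bar>y + x\<bar> / (3 * ?v) \<le> (lyap H \<bar>y\<bar> + c1 * x
      - 3 * tail_excess H \<bar>y\<bar> * trunc_sq b x + 2 * tail_moment b H * max 0 (\<bar>x\<bar> - \<bar>y\<bar>)) / (3 * ?v)"
      using c1 cv_pos by (intro divide_right_mono) auto
    moreover have "?m * lyap K \<bar>y + x\<bar> \<le> ?m * (lyap K \<bar>y\<bar> + c2 * x
      - 3 * ?hz * trunc_sq b x + 2 * tail_moment b K * max 0 (\<bar>x\<bar> - \<bar>y\<bar>))"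
      using c2 mn tail_excess_far[OF y] by (intro mult_left_mono) auto
    moreover have "(lyap H \<bar>y\<bar> + c1 * x
      - 3 * tail_excess H \<bar>y\<bar> * trunc_sq b x + 2 * tail_moment b H * max 0 (\<bar>x\<bar> - \<bar>y\<bar>)) / (3 * ?v)
      = lyap H \<bar>y\<bar> / (3 * ?v) + c1 / (3 * ?v) * x - ?h / ?v * trunc_sq b x
        + 2 * tail_moment b H / (3 * ?v) * max 0 (\<bar>x\<bar> - \<bar>y\<bar>)"
      using cv_pos by (simp add: add_divide_distrib diff_divide_distrib)
    ultimately show ?thesis by (simp only: distrib_left distrib_right right_diff_distrib mult.assoc)
  qed
  have Wn: "0 \<le> ?W x" for x
    using lyap_lipschitz(1)[of "\<bar>x\<bar>"] cv_pos tail_moment_nonneg by simp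
  have "(\<integral>\<^sup>+x. ennreal (k * (?W (y + x) + e x)) \<partial>\<mu>)
      \<le> ennreal (k * (?W y - ?g * ?v + ?l * ?hz + (\<integral>x. e x \<partial>\<mu>)))"
    by (rule expected_dominated[OF dom e(1) Wn e(2) k])
  also have "\<dots> \<le> ennreal (k * (?W y - ?h + (\<integral>x. e x \<partial>\<mu>)))"
  proof (rule ennreal_leI, rule mult_left_mono[OF _ k])
    have "?m * (2 * tail_moment b K) * ?hz \<le> ?m * (2 * ?v) * ?hz"
      using tail_moment_le mn tail_excess_nonneg[of 0 "\<bar>y\<bar>"]
      by (intro mult_right_mono mult_left_mono) (auto simp: core_variance_def)
    moreover have "?g * ?v = ?h + 3 * (?m * ?v * ?hz)" using cv_pos by (simp add: field_simps)
    moreover have "2 * tail_moment b H / (3 * ?v) * ?hz = ?m * ?v * ?hz"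
      using cv_pos by (simp add: power2_eq_square)
    moreover have "?m * (2 * ?v) * ?hz = 2 * (?m * ?v * ?hz)"
      by (simp only: mult.assoc mult.left_commute)
    ultimately show "?W y - ?g * ?v + ?l * ?hz + (\<integral>x. e x \<partial>\<mu>) \<le> ?W y - ?h + (\<integral>x. e x \<partial>\<mu>)"
      by (subst distrib_right[of _ _ ?hz]) linarith
  qed
  finally show "(\<integral>\<^sup>+x. ennreal (k * (?W (y + x) + e x)) \<partial>\<mu>)
      \<le> ennreal (k * (?W y - ?h + (\<integral>x. e x \<partial>\<mu>)))" .
qed

text \<open>A function comparable to \<open>\<bar>y\<bar>\<close> that decreases on average by \<open>1 / R\<close> in every step made in the region
  \<open>K \<le> \<bar>y\<bar> \<le> R\<close>. The parabola provides the decrease, \<open>\<bar>y\<bar>\<close> provides the size at distance \<open>R\<close>, and the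
  overshoot losses of both are paid for by the averaged cap.\<close>

lemma exit_supermartingale:
  assumes R: "b \<le> R"
  obtains F where "\<And>y. \<bar>y\<bar> \<le> F y" "\<And>y. F y \<le> (12 / core_variance + 3) * \<bar>y\<bar>"
    "\<And>y k. K \<le> \<bar>y\<bar> \<Longrightarrow> \<bar>y\<bar> \<le> R \<Longrightarrow> 0 \<le> k \<Longrightarrow>
      (\<integral>\<^sup>+x. ennreal (k * F (y + x)) \<partial>\<mu>) \<le> ennreal (k * (F y - 1 / R))"
proof
  let ?v = core_variance
  \<comment> \<open>In units of the tail excess, the overshoot losses are \<open>8 / ?v\<close> for the parabola and \<open>2\<close> for \<open>\<bar>y\<bar>\<close>,
    and the averaged cap gains at least \<open>?v\<close>.\<close>
  let ?a = "(8 / ?v + 2) / ?v"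
  let ?F = "\<lambda>y. ?a * lyap K \<bar>y\<bar> + quad_cap R \<bar>y\<bar> / (R * ?v) + \<bar>y\<bar>"
  have R0: "0 < R" using R b_pos by simp
  have an: "0 \<le> ?a" using cv_pos by simp
  have F1: "\<bar>y\<bar> \<le> ?F y" for y
    using lyap_lipschitz(1)[of "\<bar>y\<bar>"] quad_cap_lipschitz(1)[of R "\<bar>y\<bar>"] R0 cv_pos an by simp
  then show "\<bar>y\<bar> \<le> ?F y" for y .
  show "?F y \<le> (12 / ?v + 3) * \<bar>y\<bar>" for y
  proof -
    have "lyap K \<bar>y\<bar> \<le> ?v * \<bar>y\<bar>"
      using lyap_lipschitz(2)[of "\<bar>y\<bar>" K] mult_right_mono[OF tail_moment_le, of "\<bar>y\<bar>"]
      by (simp add: core_variance_def)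
    then have "?a * lyap K \<bar>y\<bar> \<le> ?a * (?v * \<bar>y\<bar>)" using an by (rule mult_left_mono)
    moreover have "?a * (?v * \<bar>y\<bar>) = (8 / ?v + 2) * \<bar>y\<bar>" using cv_pos by simp
    moreover have "quad_cap R \<bar>y\<bar> / (R * ?v) \<le> 4 * R * \<bar>y\<bar> / (R * ?v)"
      using quad_cap_lipschitz(2)[of R "\<bar>y\<bar>"] R0 cv_pos by (intro divide_right_mono) auto
    moreover have "4 * R * \<bar>y\<bar> / (R * ?v) = 4 / ?v * \<bar>y\<bar>" using R0 by simp
    moreover have "(8 / ?v + 2) * \<bar>y\<bar> + 4 / ?v * \<bar>y\<bar> + \<bar>y\<bar> = (12 / ?v + 3) * \<bar>y\<bar>"
      by (simp add: distrib_right add_divide_distrib[symmetric])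
    ultimately show ?thesis by linarith
  qed
  fix y k :: real assume y: "K \<le> \<bar>y\<bar>" "\<bar>y\<bar> \<le> R" and k: "0 \<le> k"
  have by': "b \<le> \<bar>y\<bar>" using y b_le_K by simp
  obtain c where c: "\<And>x. lyap K \<bar>y + x\<bar> \<le> lyap K \<bar>y\<bar> + c * x
      - 3 * tail_excess K \<bar>y\<bar> * trunc_sq b x + 2 * tail_moment b K * max 0 (\<bar>x\<bar> - \<bar>y\<bar>)"
    using lyap_reflected[OF by'] by blast
  let ?hz = "tail_excess 0 \<bar>y\<bar>"
  let ?d = "2 * max 0 (2 * R - \<bar>y\<bar>) * sgn y"
  let ?g = "?a * (3 * ?hz) + 1 / (R * ?v)"
  let ?l = "?a * (2 * tail_moment b K) + 8 / ?v + 2"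
  have dom: "?F (y + x) \<le> ?F y + (?a * c + ?d / (R * ?v) + sgn y) * x - ?g * trunc_sq b x + ?l * max 0 (\<bar>x\<bar> - \<bar>y\<bar>)" for x
  proof -
    have "?a * lyap K \<bar>y + x\<bar> \<le> ?a * (lyap K \<bar>y\<bar> + c * x
      - 3 * ?hz * trunc_sq b x + 2 * tail_moment b K * max 0 (\<bar>x\<bar> - \<bar>y\<bar>))"
      using c an tail_excess_far[OF y(1)] by (intro mult_left_mono) auto
    moreover have "quad_cap R \<bar>y + x\<bar> / (R * ?v) \<le> (quad_cap R \<bar>y\<bar> + ?d * x
      - trunc_sq b x + 2 * (4 * R) * max 0 (\<bar>x\<bar> - \<bar>y\<bar>)) / (R * ?v)"
      using quad_cap_reflected[OF b_pos by' R, of x] y R0 cv_pos by (intro divide_right_mono) auto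
    moreover have "(quad_cap R \<bar>y\<bar> + ?d * x
      - trunc_sq b x + 2 * (4 * R) * max 0 (\<bar>x\<bar> - \<bar>y\<bar>)) / (R * ?v)
      = quad_cap R \<bar>y\<bar> / (R * ?v) + ?d / (R * ?v) * x - 1 / (R * ?v) * trunc_sq b x
        + 8 / ?v * max 0 (\<bar>x\<bar> - \<bar>y\<bar>)"
      using cv_pos R0 by (simp add: add_divide_distrib diff_divide_distrib)
    moreover have "\<bar>y + x\<bar> \<le> \<bar>y\<bar> + sgn y * x + 2 * max 0 (\<bar>x\<bar> - \<bar>y\<bar>)"
      using abs_reflected[OF b_pos by', of x] by simp
    ultimately show ?thesis by (simp only: distrib_left distrib_right right_diff_distrib mult.assoc)
  qed
  have Fn: "0 \<le> ?F x" for x using F1[of x] by linarith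
  have "(\<integral>\<^sup>+x. ennreal (k * (?F (y + x) + 0)) \<partial>\<mu>)
      \<le> ennreal (k * (?F y - ?g * ?v + ?l * ?hz + (\<integral>x. 0 \<partial>\<mu>)))"
    by (rule expected_dominated[OF dom _ Fn _ k]) auto
  also have "\<dots> \<le> ennreal (k * (?F y - 1 / R))"
  proof (rule ennreal_leI, rule mult_left_mono[OF _ k])
    have "?a * (2 * tail_moment b K) * ?hz \<le> ?a * (2 * ?v) * ?hz"
      using tail_moment_le an tail_excess_nonneg[of 0 "\<bar>y\<bar>"]
      by (intro mult_right_mono mult_left_mono) (auto simp: core_variance_def)
    moreover have "?a * ?v = 8 / ?v + 2" using cv_pos by simp
    then have "?a * ?v * ?hz = 8 / ?v * ?hz + 2 * ?hz" by (simp only: distrib_right)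
    moreover have "?g * ?v = 3 * (?a * ?v * ?hz) + 1 / R" using cv_pos R0 by (simp add: field_simps)
    moreover have "?a * (2 * ?v) * ?hz = 2 * (?a * ?v * ?hz)" by (simp only: mult.assoc mult.left_commute)
    ultimately show "?F y - ?g * ?v + ?l * ?hz + (\<integral>x. 0 \<partial>\<mu>) \<le> ?F y - 1 / R"
      by (simp only: distrib_right) simp
  qed
  finally show "(\<integral>\<^sup>+x. ennreal (k * ?F (y + x)) \<partial>\<mu>) \<le> ennreal (k * (?F y - 1 / R))"
    by (simp only: add_0_right)
qed

end

section \<open>Probabilities of avoiding and of jumping across an interval\<close>

context avoiding_walk
begin

text \<open>The probability that the walk started at \<open>y\<close> does not enter the interval during \<open>m\<close> steps,
  by decomposition at the first step.\<close>

primrec avoid :: "nat \<Rightarrow> real \<Rightarrow> ennreal" where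
  "avoid 0 y = 1"
| "avoid (Suc m) y = (\<integral>\<^sup>+x. (if K \<le> \<bar>y + x\<bar> then avoid m (y + x) else 0) \<partial>\<mu>)"

text \<open>An upper bound for the probability that during the first \<open>l\<close> steps, before entering the
  interval, the walk jumps across the origin by at least \<open>H\<close>, and then avoids the interval for another
  \<open>N\<close> steps. Since the clock is restarted at the jump, every such jump contributes and
  the recursion stays linear.\<close>

primrec cross :: "real \<Rightarrow> nat \<Rightarrow> nat \<Rightarrow> real \<Rightarrow> ennreal" where
  "cross H N 0 y = 0"
| "cross H N (Suc l) y = (\<integral>\<^sup>+x. (if K \<le> \<bar>y + x\<bar> then
      (if H \<le> \<bar>x\<bar> \<and> y * (y + x) \<le> 0 then avoid N (y + x) else 0) + cross H N l (y + x)
    else 0) \<partial>\<mu>)"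

lemma borel_measurable_avoid [measurable]: "avoid m \<in> borel_measurable borel"
  by (induction m) (simp_all cong: measurable_cong)

lemma avoid_antimono: "avoid (Suc m) y \<le> avoid m y"
proof (induction m arbitrary: y)
  case 0
  have "avoid (Suc 0) y \<le> (\<integral>\<^sup>+x. 1 \<partial>\<mu>)" by (simp del: nn_integral_const) (intro nn_integral_mono, auto)
  then show ?case by (simp add: emeasure_space_1)
next
  case (Suc m)
  have "avoid (Suc (Suc m)) y = (\<integral>\<^sup>+x. (if K \<le> \<bar>y + x\<bar> then avoid (Suc m) (y + x) else 0) \<partial>\<mu>)"
    by (rule avoid.simps)
  also have "\<dots> \<le> (\<integral>\<^sup>+x. (if K \<le> \<bar>y + x\<bar> then avoid m (y + x) else 0) \<partial>\<mu>)"
    using Suc by (intro nn_integral_mono) auto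
  finally show ?case by simp
qed

lemma avoid_decreasing: "m \<le> n \<Longrightarrow> avoid n y \<le> avoid m y"
  by (rule lift_Suc_antimono_le[of "\<lambda>m. avoid m y"]) (rule avoid_antimono)

text \<open>The sum is the expected number of steps, out of the first \<open>m\<close>, made before the walk enters the interval. In
  the region \<open>\<bar>y\<bar> \<le> R\<close> each step is paid for by the drift of \<open>R * F\<close>, and once \<open>\<bar>y\<bar> > R\<close>
  the value \<open>R * F y \<ge> R\<^sup>2\<close> covers all remaining steps. This single induction replaces
  stopping at the exit from the region.\<close>

lemma sum_avoid_le:
  assumes F: "\<And>y. \<bar>y\<bar> \<le> F y"
    and drift: "\<And>y k. K \<le> \<bar>y\<bar> \<Longrightarrow> \<bar>y\<bar> \<le> R \<Longrightarrow> 0 \<le> k \<Longrightarrow>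
      (\<integral>\<^sup>+x. ennreal (k * F (y + x)) \<partial>\<mu>) \<le> ennreal (k * (F y - 1 / R))"
    and R: "0 < R" "1 / R \<le> K" and m: "real m \<le> R\<^sup>2" and y: "K \<le> \<bar>y\<bar>"
  shows "(\<Sum>j<m. avoid j y) \<le> ennreal (R * F y)"
  using m y
proof (induction m arbitrary: y)
  case (Suc m)
  show ?case
  proof (cases "\<bar>y\<bar> \<le> R")
    case True
    have "(\<Sum>j<Suc m. avoid j y) = 1 + (\<Sum>j<m. avoid (Suc j) y)"
      by (simp add: sum.lessThan_Suc_shift del: avoid.simps(2) sum.lessThan_Suc)
    also have "(\<Sum>j<m. avoid (Suc j) y)
        = (\<integral>\<^sup>+x. (\<Sum>j<m. if K \<le> \<bar>y + x\<bar> then avoid j (y + x) else 0) \<partial>\<mu>)"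
      by (subst nn_integral_sum) auto
    also have "\<dots> \<le> (\<integral>\<^sup>+x. ennreal (R * F (y + x)) \<partial>\<mu>)"
    proof (rule nn_integral_mono)
      fix x
      show "(\<Sum>j<m. if K \<le> \<bar>y + x\<bar> then avoid j (y + x) else 0) \<le> ennreal (R * F (y + x))"
        using Suc.IH[of "y + x"] Suc.prems(1) by (cases "K \<le> \<bar>y + x\<bar>") auto
    qed
    also have "\<dots> \<le> ennreal (R * (F y - 1 / R))"
      using drift[OF Suc.prems(2) True] R(1) by simp
    also have "1 + ennreal (R * (F y - 1 / R)) = ennreal (R * F y)"
    proof -
      have "R * (1 / R) \<le> R * F y"
        using F[of y] R Suc.prems(2) by (intro mult_left_mono) auto
      then have "0 \<le> R * F y - 1" using R(1) by simp
      then have "ennreal 1 + ennreal (R * F y - 1) = ennreal (1 + (R * F y - 1))"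
        by (intro ennreal_plus[symmetric]) auto
      then show ?thesis using R(1) by (simp add: right_diff_distrib)
    qed
    finally show ?thesis by (simp add: add_left_mono)
  next
    case False
    have "(\<Sum>j<Suc m. avoid j y) \<le> (\<Sum>j<Suc m. 1)"
      using avoid_decreasing[of 0] by (intro sum_mono) auto
    also have "\<dots> = ennreal (real (Suc m))" by (simp add: ennreal_of_nat_eq_real_of_nat)
    also have "\<dots> \<le> ennreal (R * F y)"
    proof (rule ennreal_leI)
      have "R * R \<le> R * F y" using False R(1) F[of y] by (intro mult_left_mono) auto
      then show "real (Suc m) \<le> R * F y" using Suc.prems(1) by (simp add: power2_eq_square)
    qed
    finally show ?thesis .
  qed
qed simp

text \<open>As \<open>avoid m y\<close> decreases in \<open>m\<close>, it is at most the average of its first \<open>m\<close> values, to which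
  \<open>sum_avoid_le\<close> applies with \<open>R = sqrt m\<close>. The finitely many \<open>m\<close> for which this \<open>R\<close> is too
  small are absorbed into the constant.\<close>

lemma avoid_decay:
  obtains C where "0 \<le> C"
    "\<And>m y. K \<le> \<bar>y\<bar> \<Longrightarrow> avoid m y \<le> ennreal (C * \<bar>y\<bar> / sqrt (real m + 1))"
proof
  let ?C1 = "12 / core_variance + 3"
  let ?R = "max b (1 / K)"
  let ?C2 = "(?R + 1) / K"
  have c: "0 \<le> ?C1" "0 \<le> ?C2" using cv_pos K_pos b_pos by auto
  show "0 \<le> 2 * ?C1 + ?C2" using c by simp
  fix m y assume y: "K \<le> \<bar>y\<bar>"
  show "avoid m y \<le> ennreal ((2 * ?C1 + ?C2) * \<bar>y\<bar> / sqrt (real m + 1))"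
  proof (cases "?R \<le> sqrt (real m)")
    case True
    let ?r = "sqrt (real m)"
    have br: "b \<le> ?r" using True by simp
    then have r: "0 < ?r" "b \<le> ?r" using b_pos by linarith+
    have m0: "m > 0" using r by (cases m) auto
    obtain F where F: "\<And>y. \<bar>y\<bar> \<le> F y" "\<And>y. F y \<le> ?C1 * \<bar>y\<bar>"
      and drift: "\<And>y k. K \<le> \<bar>y\<bar> \<Longrightarrow> \<bar>y\<bar> \<le> ?r \<Longrightarrow> 0 \<le> k \<Longrightarrow>
        (\<integral>\<^sup>+x. ennreal (k * F (y + x)) \<partial>\<mu>) \<le> ennreal (k * (F y - 1 / ?r))"
      using exit_supermartingale[OF r(2)] by blast
    have rK: "1 / ?r \<le> K" using True K_pos r(1) by (simp add: field_simps)
    have "of_nat m * avoid m y \<le> (\<Sum>j<m. avoid j y)"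
      using sum_mono[of "{..<m}" "\<lambda>_. avoid m y" "\<lambda>j. avoid j y"] avoid_decreasing by simp
    also have "\<dots> \<le> ennreal (?r * F y)"
      by (rule sum_avoid_le[OF F(1) drift r(1) rK]) (use y in auto)
    also have "\<dots> \<le> ennreal (?r * (?C1 * \<bar>y\<bar>))"
      using F(2)[of y] r(1) by (intro ennreal_leI mult_left_mono) auto
    finally have 1: "ennreal (real m) * avoid m y \<le> ennreal (?r * (?C1 * \<bar>y\<bar>))"
      by (simp add: ennreal_of_nat_eq_real_of_nat)
    have "avoid m y = ennreal (1 / real m) * (ennreal (real m) * avoid m y)"
      using m0 by (simp add: mult.assoc[symmetric] ennreal_mult'[symmetric])
    also have "\<dots> \<le> ennreal (1 / real m) * ennreal (?r * (?C1 * \<bar>y\<bar>))"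
      by (rule mult_left_mono[OF 1]) simp
    also have "\<dots> = ennreal (?C1 * \<bar>y\<bar> * (?r / real m))"
      by (simp add: ennreal_mult'[symmetric] mult_ac)
    also have "?r / real m = 1 / ?r"
      using m0 by (simp add: real_div_sqrt field_simps)
    also have "ennreal (?C1 * \<bar>y\<bar> * (1 / ?r)) \<le> ennreal ((2 * ?C1 + ?C2) * \<bar>y\<bar> / sqrt (real m + 1))"
    proof (rule ennreal_leI)
      have "sqrt (real m + 1) \<le> sqrt (4 * real m)" using m0 by (intro real_sqrt_le_mono) auto
      then have "sqrt (real m + 1) \<le> 2 * ?r" by (simp add: real_sqrt_mult)
      then have "1 / ?r \<le> 2 / sqrt (real m + 1)" using r(1) by (simp add: field_simps)
      then have "?C1 * \<bar>y\<bar> * (1 / ?r) \<le> ?C1 * \<bar>y\<bar> * (2 / sqrt (real m + 1))"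
        using c by (intro mult_left_mono) auto
      also have "\<dots> = (2 * ?C1) * \<bar>y\<bar> / sqrt (real m + 1)" by simp
      also have "\<dots> \<le> (2 * ?C1 + ?C2) * \<bar>y\<bar> / sqrt (real m + 1)"
        using c by (intro divide_right_mono mult_right_mono) auto
      finally show "?C1 * \<bar>y\<bar> * (1 / ?r) \<le> (2 * ?C1 + ?C2) * \<bar>y\<bar> / sqrt (real m + 1)" .
    qed
    finally show ?thesis .
  next
    case False
    have "sqrt (real m + 1) \<le> sqrt (real m) + sqrt 1" by (rule sqrt_add_le_add_sqrt) auto
    then have s: "sqrt (real m + 1) \<le> ?R + 1" using False unfolding real_sqrt_one by linarith
    have "avoid m y \<le> avoid 0 y" by (rule avoid_decreasing) simp
    also have "avoid 0 y = ennreal 1" by simp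
    also have "\<dots> \<le> ennreal ((2 * ?C1 + ?C2) * \<bar>y\<bar> / sqrt (real m + 1))"
    proof (rule ennreal_leI)
      have "sqrt (real m + 1) \<le> ?C2 * K" using s K_pos by simp
      also have "\<dots> \<le> ?C2 * \<bar>y\<bar>" using y c by (intro mult_left_mono) auto
      also have "\<dots> \<le> (2 * ?C1 + ?C2) * \<bar>y\<bar>" using c by (intro mult_right_mono) auto
      finally show "1 \<le> (2 * ?C1 + ?C2) * \<bar>y\<bar> / sqrt (real m + 1)" by simp
    qed
    finally show ?thesis .
  qed
qed

lemma opposite_signs_abs:
  fixes x y :: real assumes "y * (y + x) \<le> 0" shows "\<bar>y + x\<bar> = \<bar>x\<bar> - \<bar>y\<bar>"
  using assms by (auto simp: mult_le_0_iff abs_if)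

text \<open>The probability of surviving \<open>N\<close> steps after a jump is proportional to the distance at which the jump lands,
  and the expected sum of these distances is at most \<open>W y\<close>.\<close>

lemma cross_decay:
  assumes H: "K \<le> H" and C: "0 \<le> C"
    "\<And>m y. K \<le> \<bar>y\<bar> \<Longrightarrow> avoid m y \<le> ennreal (C * \<bar>y\<bar> / sqrt (real m + 1))"
    and y: "K \<le> \<bar>y\<bar>"
  shows "cross H N l y \<le> ennreal (C * tail_moment b H / core_variance * \<bar>y\<bar> / sqrt (real N + 1))"
proof -
  obtain W where W: "\<And>y. 0 \<le> W y" "\<And>y. W y \<le> (1 / core_variance) * tail_moment b H * \<bar>y\<bar>"
    and drift: "\<And>y e k. K \<le> \<bar>y\<bar> \<Longrightarrow> integrable \<mu> e \<Longrightarrow> (\<And>x. 0 \<le> e x) \<Longrightarrow> 0 \<le> k \<Longrightarrow>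
      (\<integral>\<^sup>+x. ennreal (k * (W (y + x) + e x)) \<partial>\<mu>)
        \<le> ennreal (k * (W y - tail_excess H \<bar>y\<bar> + (\<integral>x. e x \<partial>\<mu>)))"
    using lyap_supermartingale[OF H] by blast
  let ?c = "C / sqrt (real N + 1)"
  have c: "0 \<le> ?c" using C by simp
  have "cross H N l y \<le> ennreal (?c * W y)" using y
  proof (induction l arbitrary: y)
    case (Suc l)
    let ?e = "\<lambda>x. if H \<le> \<bar>x\<bar> then max 0 (\<bar>x\<bar> - \<bar>y\<bar>) else 0"
    have "cross H N (Suc l) y \<le> (\<integral>\<^sup>+x. ennreal (?c * (W (y + x) + ?e x)) \<partial>\<mu>)"
      unfolding cross.simps
    proof (rule nn_integral_mono)
      fix x
      have jump: "avoid N (y + x) \<le> ennreal (?c * ?e x)"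
        if "K \<le> \<bar>y + x\<bar>" "H \<le> \<bar>x\<bar>" "y * (y + x) \<le> 0"
        using C(2)[OF that(1), of N] opposite_signs_abs[OF that(3)] that K_pos by simp
      have e0: "0 \<le> ?c * ?e x" using c by (intro mult_nonneg_nonneg) auto
      have "(if H \<le> \<bar>x\<bar> \<and> y * (y + x) \<le> 0 then avoid N (y + x) else 0) + cross H N l (y + x)
          \<le> ennreal (?c * ?e x) + ennreal (?c * W (y + x))" if "K \<le> \<bar>y + x\<bar>"
        using that jump Suc.IH[OF that] by (intro add_mono) auto
      also have "ennreal (?c * ?e x) + ennreal (?c * W (y + x)) = ennreal (?c * (W (y + x) + ?e x))"
        using e0 W(1)[of "y + x"] c
        by (subst ennreal_plus[symmetric]) (auto simp only: distrib_left add.commute mult_nonneg_nonneg)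
      finally show "(if K \<le> \<bar>y + x\<bar> then
          (if H \<le> \<bar>x\<bar> \<and> y * (y + x) \<le> 0 then avoid N (y + x) else 0) + cross H N l (y + x)
        else 0) \<le> ennreal (?c * (W (y + x) + ?e x))" by simp
    qed
    also have "\<dots> \<le> ennreal (?c * (W y - tail_excess H \<bar>y\<bar> + (\<integral>x. ?e x \<partial>\<mu>)))"
      by (rule drift[OF Suc.prems integrable_excess _ c]) auto
    also have "\<dots> = ennreal (?c * W y)" by (simp add: tail_excess_def)
    finally show ?case .
  qed simp
  also have "\<dots> \<le> ennreal (?c * ((1 / core_variance) * tail_moment b H * \<bar>y\<bar>))"
    using W(2) c by (intro ennreal_leI mult_left_mono) auto
  also have "?c * ((1 / core_variance) * tail_moment b H * \<bar>y\<bar>)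
      = C * tail_moment b H / core_variance * \<bar>y\<bar> / sqrt (real N + 1)" by (simp add: mult_ac)
  finally show ?thesis .
qed

end

section \<open>The walk on the space of increment sequences\<close>

definition walk_from :: "real \<Rightarrow> (nat \<Rightarrow> real) \<Rightarrow> nat \<Rightarrow> real" where
  "walk_from y \<omega> j = y + (\<Sum>t<j. \<omega> t)"

definition avoids :: "real \<Rightarrow> nat \<Rightarrow> real \<Rightarrow> (nat \<Rightarrow> real) \<Rightarrow> bool" where
  "avoids K m y \<omega> \<longleftrightarrow> (\<forall>j\<in>{1..m}. K \<le> \<bar>walk_from y \<omega> j\<bar>)"

definition jumps_across :: "real \<Rightarrow> nat \<Rightarrow> real \<Rightarrow> (nat \<Rightarrow> real) \<Rightarrow> bool" where
  "jumps_across H l y \<omega> \<longleftrightarrow> (\<exists>t<l. H \<le> \<bar>\<omega> t\<bar> \<and> walk_from y \<omega> t * walk_from y \<omega> (Suc t) \<le> 0)"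

lemma walk_from_0 [simp]: "walk_from y \<omega> 0 = y"
  by (simp add: walk_from_def)

lemma walk_from_Suc: "walk_from y \<omega> (Suc j) = walk_from y \<omega> j + \<omega> j"
  by (simp add: walk_from_def)

lemma walk_from_case_nat: "walk_from y (case_nat x \<omega>) (Suc j) = walk_from (y + x) \<omega> j"
  by (simp add: walk_from_def sum.lessThan_Suc_shift del: sum.lessThan_Suc)

lemma walk_from_cong: "(\<And>t. t < j \<Longrightarrow> \<omega> t = \<omega>' t) \<Longrightarrow> walk_from y \<omega> j = walk_from y \<omega>' j"
  by (simp add: walk_from_def)

lemma avoids_0 [simp]: "avoids K 0 y \<omega>"
  by (simp add: avoids_def)

lemma avoids_case_nat:
  "avoids K (Suc m) y (case_nat x \<omega>) \<longleftrightarrow> K \<le> \<bar>y + x\<bar> \<and> avoids K m (y + x) \<omega>"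
proof -
  have *: "{1..Suc m} = insert 1 (Suc ` {1..m})"
    by (simp add: image_Suc_atLeastAtMost atLeastAtMost_insertL)
  have "avoids K (Suc m) y (case_nat x \<omega>) \<longleftrightarrow> K \<le> \<bar>walk_from y (case_nat x \<omega>) 1\<bar>
      \<and> (\<forall>j\<in>{1..m}. K \<le> \<bar>walk_from y (case_nat x \<omega>) (Suc j)\<bar>)"
    unfolding avoids_def * by blast
  then show ?thesis
    by (simp add: avoids_def walk_from_case_nat walk_from_case_nat[of _ _ _ 0, simplified])
qed

lemma avoids_mono: "avoids K m y \<omega> \<Longrightarrow> n \<le> m \<Longrightarrow> avoids K n y \<omega>"
  by (auto simp: avoids_def)

lemma jumps_across_case_nat:
  "jumps_across H (Suc l) y (case_nat x \<omega>) \<longleftrightarrow>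
    (H \<le> \<bar>x\<bar> \<and> y * (y + x) \<le> 0) \<or> jumps_across H l (y + x) \<omega>"
  unfolding jumps_across_def Ex_less_Suc2
  by (simp add: walk_from_case_nat walk_from_case_nat[of _ _ _ 0, simplified])

lemma avoids_cong: "(\<And>t. t < m \<Longrightarrow> \<omega> t = \<omega>' t) \<Longrightarrow> avoids K m y \<omega> = avoids K m y \<omega>'"
  unfolding avoids_def by (intro ball_cong refl) (simp cong: walk_from_cong)

lemma jumps_across_cong:
  "(\<And>t. t < l \<Longrightarrow> \<omega> t = \<omega>' t) \<Longrightarrow> jumps_across H l y \<omega> = jumps_across H l y \<omega>'"
  unfolding jumps_across_def
  by (intro ex_cong1 conj_cong refl) (auto simp: walk_from_Suc cong: walk_from_cong)

context avoiding_walk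
begin

sublocale seq: sequence_space \<mu> ..

lemma space_law [simp]: "space \<mu> = UNIV"
  using sets_eq_imp_space_eq[OF sets_law] by simp

lemma space_seq [simp]: "space seq.S = UNIV"
  by (simp add: space_PiM)

lemma measurable_coord [measurable]: "(\<lambda>\<omega>. \<omega> t) \<in> borel_measurable seq.S"
proof -
  have "(\<lambda>\<omega>. \<omega> t) \<in> measurable seq.S \<mu>" by (rule measurable_component_singleton) simp
  then show ?thesis by simp
qed

lemma measurable_walk_from [measurable]: "(\<lambda>\<omega>. walk_from y \<omega> j) \<in> borel_measurable seq.S"
  unfolding walk_from_def by measurable

lemma measurable_avoids [measurable]: "Measurable.pred seq.S (avoids K' m y)"
  unfolding avoids_def[abs_def] by measurable

lemma measurable_jumps_across [measurable]: "Measurable.pred seq.S (jumps_across H l y)"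
  unfolding jumps_across_def[abs_def] by measurable

text \<open>The Markov property at the first step.\<close>

lemma emeasure_first_step:
  assumes A: "Measurable.pred seq.S A"
  shows "emeasure seq.S {\<omega>. A \<omega>} = (\<integral>\<^sup>+x. emeasure seq.S {\<omega>. A (case_nat x \<omega>)} \<partial>\<mu>)"
proof -
  have A': "{\<omega>. A \<omega>} \<in> sets seq.S" using predE[OF A] by simp
  have m: "(\<lambda>(s, \<omega>). case_nat s \<omega>) \<in> measurable (\<mu> \<Otimes>\<^sub>M seq.S) seq.S" by measurable
  have "emeasure seq.S {\<omega>. A \<omega>} = emeasure (distr (\<mu> \<Otimes>\<^sub>M seq.S) seq.S (\<lambda>(s, \<omega>). case_nat s \<omega>)) {\<omega>. A \<omega>}"
    by (subst seq.PiM_iter) rule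
  also have "\<dots> = emeasure (\<mu> \<Otimes>\<^sub>M seq.S) ((\<lambda>(s, \<omega>). case_nat s \<omega>) -` {\<omega>. A \<omega>} \<inter> space (\<mu> \<Otimes>\<^sub>M seq.S))"
    by (rule emeasure_distr[OF m A'])
  also have "\<dots> = (\<integral>\<^sup>+x. emeasure seq.S (Pair x -` ((\<lambda>(s, \<omega>). case_nat s \<omega>) -` {\<omega>. A \<omega>} \<inter> space (\<mu> \<Otimes>\<^sub>M seq.S))) \<partial>\<mu>)"
    by (rule seq.P.emeasure_pair_measure_alt[OF measurable_sets[OF m A']])
  also have "\<dots> = (\<integral>\<^sup>+x. emeasure seq.S {\<omega>. A (case_nat x \<omega>)} \<partial>\<mu>)"
    by (intro nn_integral_cong arg_cong[where f = "emeasure seq.S"]) (auto simp: space_pair_measure)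
  finally show ?thesis .
qed

text \<open>Independence of the first \<open>n\<close> increments from the later ones.\<close>

lemma emeasure_split:
  assumes A: "Measurable.pred seq.S A" and B: "Measurable.pred seq.S B"
    and prefix: "\<And>\<omega> \<omega>'. (\<And>t. t < n \<Longrightarrow> \<omega> t = \<omega>' t) \<Longrightarrow> A \<omega> = A \<omega>'"
  shows "emeasure seq.S {\<omega>. A \<omega> \<and> B (\<lambda>t. \<omega> (t + n))} = emeasure seq.S {\<omega>. A \<omega>} * emeasure seq.S {\<omega>. B \<omega>}"
proof -
  let ?f = "\<lambda>(\<omega>, \<omega>'). comb_seq n \<omega> \<omega>'"
  have shift: "(\<lambda>\<omega> t. \<omega> (t + n)) \<in> measurable seq.S seq.S"
    by (rule measurable_PiM_single') (auto intro: measurable_component_singleton)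
  have AB: "{\<omega>. A \<omega> \<and> B (\<lambda>t. \<omega> (t + n))} \<in> sets seq.S"
  proof -
    have "Measurable.pred seq.S (\<lambda>\<omega>. B (\<lambda>t. \<omega> (t + n)))"
      using measurable_compose[OF shift B] .
    with A have "Measurable.pred seq.S (\<lambda>\<omega>. A \<omega> \<and> B (\<lambda>t. \<omega> (t + n)))" by measurable
    from predE[OF this] show ?thesis by simp
  qed
  have m: "?f \<in> measurable (seq.S \<Otimes>\<^sub>M seq.S) seq.S" by (rule measurable_comb_seq)
  have "emeasure seq.S {\<omega>. A \<omega> \<and> B (\<lambda>t. \<omega> (t + n))}
      = emeasure (distr (seq.S \<Otimes>\<^sub>M seq.S) seq.S ?f) {\<omega>. A \<omega> \<and> B (\<lambda>t. \<omega> (t + n))}"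
    by (subst seq.PiM_comb_seq) rule
  also have "\<dots> = emeasure (seq.S \<Otimes>\<^sub>M seq.S) (?f -` {\<omega>. A \<omega> \<and> B (\<lambda>t. \<omega> (t + n))} \<inter> space (seq.S \<Otimes>\<^sub>M seq.S))"
    by (rule emeasure_distr[OF m AB])
  also have "?f -` {\<omega>. A \<omega> \<and> B (\<lambda>t. \<omega> (t + n))} \<inter> space (seq.S \<Otimes>\<^sub>M seq.S) = {\<omega>. A \<omega>} \<times> {\<omega>. B \<omega>}"
  proof -
    have "A (comb_seq n \<omega> \<omega>') = A \<omega>" for \<omega> \<omega>' by (rule prefix) (rule comb_seq_less)
    moreover have "(\<lambda>t. comb_seq n \<omega> \<omega>' (t + n)) = \<omega>'" for \<omega> \<omega>' :: "nat \<Rightarrow> real"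
      by (simp add: comb_seq_add)
    ultimately show ?thesis by (auto simp: space_pair_measure)
  qed
  also have "emeasure (seq.S \<Otimes>\<^sub>M seq.S) ({\<omega>. A \<omega>} \<times> {\<omega>. B \<omega>}) = emeasure seq.S {\<omega>. A \<omega>} * emeasure seq.S {\<omega>. B \<omega>}"
    using predE[OF A] predE[OF B] by (intro seq.P.emeasure_pair_measure_Times) auto
  finally show ?thesis .
qed

lemma emeasure_avoids: "emeasure seq.S {\<omega>. avoids K m y \<omega>} = avoid m y"
proof (induction m arbitrary: y)
  case 0
  then show ?case using seq.P.emeasure_space_1 by simp
next
  case (Suc m)
  have "emeasure seq.S {\<omega>. avoids K (Suc m) y \<omega>}
      = (\<integral>\<^sup>+x. emeasure seq.S {\<omega>. avoids K (Suc m) y (case_nat x \<omega>)} \<partial>\<mu>)"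
    by (rule emeasure_first_step) measurable
  also have "\<dots> = avoid (Suc m) y"
    unfolding avoid.simps by (intro nn_integral_cong) (auto simp: avoids_case_nat Suc.IH)
  finally show ?case .
qed

lemma emeasure_jumps_across:
  "emeasure seq.S {\<omega>. avoids K (l + N) y \<omega> \<and> jumps_across H l y \<omega>} \<le> cross H N l y"
proof (induction l arbitrary: y)
  case 0
  then show ?case by (simp add: jumps_across_def)
next
  case (Suc l)
  have "emeasure seq.S {\<omega>. avoids K (Suc l + N) y \<omega> \<and> jumps_across H (Suc l) y \<omega>}
      = (\<integral>\<^sup>+x. emeasure seq.S {\<omega>. avoids K (Suc l + N) y (case_nat x \<omega>) \<and> jumps_across H (Suc l) y (case_nat x \<omega>)} \<partial>\<mu>)"
    by (rule emeasure_first_step) measurable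
  also have "\<dots> \<le> cross H N (Suc l) y"
    unfolding cross.simps
  proof (rule nn_integral_mono)
    fix x
    let ?E = "{\<omega>. avoids K (Suc l + N) y (case_nat x \<omega>) \<and> jumps_across H (Suc l) y (case_nat x \<omega>)}"
    let ?J = "{\<omega>. avoids K (l + N) (y + x) \<omega> \<and> jumps_across H l (y + x) \<omega>}"
    have J: "?J \<in> sets seq.S"
    proof -
      have "Measurable.pred seq.S (\<lambda>\<omega>. avoids K (l + N) (y + x) \<omega> \<and> jumps_across H l (y + x) \<omega>)"
        by measurable
      from predE[OF this] show ?thesis by simp
    qed
    have V: "{\<omega>. avoids K N (y + x) \<omega>} \<in> sets seq.S"
      using predE[OF measurable_avoids[of K N "y + x"]] by simp
    show "emeasure seq.S ?E \<le> (if K \<le> \<bar>y + x\<bar> then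
      (if H \<le> \<bar>x\<bar> \<and> y * (y + x) \<le> 0 then avoid N (y + x) else 0) + cross H N l (y + x)
    else 0)"
    proof (cases "K \<le> \<bar>y + x\<bar>")
      case True
      show ?thesis
      proof (cases "H \<le> \<bar>x\<bar> \<and> y * (y + x) \<le> 0")
        case jump: True
        \<comment> \<open>If the first step is the jump, only the next \<open>N\<close> of the remaining \<open>l + N\<close> steps are kept.\<close>
        have "?E \<subseteq> {\<omega>. avoids K N (y + x) \<omega>} \<union> ?J"
          by (auto simp: avoids_case_nat jumps_across_case_nat intro: avoids_mono)
        then have "emeasure seq.S ?E \<le> emeasure seq.S ({\<omega>. avoids K N (y + x) \<omega>} \<union> ?J)"
          using J V by (intro emeasure_mono) auto
        also have "\<dots> \<le> emeasure seq.S {\<omega>. avoids K N (y + x) \<omega>} + emeasure seq.S ?J"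
          by (rule emeasure_subadditive[OF V J])
        also have "\<dots> \<le> avoid N (y + x) + cross H N l (y + x)"
          by (intro add_mono Suc.IH) (simp add: emeasure_avoids)
        finally show ?thesis using True jump by simp
      next
        case nojump: False
        have "?E \<subseteq> ?J" using nojump by (auto simp: avoids_case_nat jumps_across_case_nat)
        then have "emeasure seq.S ?E \<le> emeasure seq.S ?J" using J by (intro emeasure_mono) auto
        also have "\<dots> \<le> cross H N l (y + x)" by (rule Suc.IH)
        finally show ?thesis by (subst if_P[OF True], subst if_not_P[OF nojump]) simp
      qed
    next
      case False
      then show ?thesis by (simp add: avoids_case_nat)
    qed
  qed
  finally show ?case .
qed

text \<open>The jump is required in the first half of the time, so at least \<open>m div 2\<close> steps remain after
  it and \<open>cross_decay\<close> still yields the rate \<open>1 / sqrt m\<close>.\<close>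

lemma two_sided_bounds:
  obtains C where "0 \<le> C"
    "\<And>m y. \<bar>y\<bar> = K \<Longrightarrow> emeasure seq.S {\<omega>. avoids K m y \<omega>} \<le> ennreal (C / sqrt (real m + 1))"
    "\<And>H m y. K \<le> H \<Longrightarrow> \<bar>y\<bar> = K \<Longrightarrow>
      emeasure seq.S {\<omega>. avoids K m y \<omega> \<and> jumps_across H ((m + 1) div 2) y \<omega>}
        \<le> ennreal (C * tail_moment b H / sqrt (real m + 1))"
proof -
  obtain C where C: "0 \<le> C"
    "\<And>m y. K \<le> \<bar>y\<bar> \<Longrightarrow> avoid m y \<le> ennreal (C * \<bar>y\<bar> / sqrt (real m + 1))"
    using avoid_decay by blast
  let ?D = "C * K + 2 * (C * K / core_variance)"
  have n: "0 \<le> C * K" "0 \<le> C * K / core_variance" using C(1) K_pos cv_pos by auto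
  show ?thesis
  proof (rule that[of ?D])
    show "0 \<le> ?D" using n by simp
  next
    fix m :: nat and y :: real assume y: "\<bar>y\<bar> = K"
    have "emeasure seq.S {\<omega>. avoids K m y \<omega>} \<le> ennreal (C * K / sqrt (real m + 1))"
      using C(2)[of y m] y by (simp add: emeasure_avoids)
    also have "\<dots> \<le> ennreal (?D / sqrt (real m + 1))"
      using n by (intro ennreal_leI divide_right_mono) auto
    finally show "emeasure seq.S {\<omega>. avoids K m y \<omega>} \<le> ennreal (?D / sqrt (real m + 1))" .
  next
    fix H y :: real and m :: nat assume H: "K \<le> H" and y: "\<bar>y\<bar> = K"
    let ?l = "(m + 1) div 2" and ?N = "m div 2"
    have m: "m = ?l + ?N" by presburger
    have "emeasure seq.S {\<omega>. avoids K m y \<omega> \<and> jumps_across H ?l y \<omega>} \<le> cross H ?N ?l y"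
      using emeasure_jumps_across[of ?l ?N y H] m by simp
    also have "\<dots> \<le> ennreal (C * tail_moment b H / core_variance * \<bar>y\<bar> / sqrt (real ?N + 1))"
      using cross_decay[OF H C, of y] y by simp
    also have "\<dots> \<le> ennreal (?D * tail_moment b H / sqrt (real m + 1))"
    proof (rule ennreal_leI)
      have "m + 1 \<le> 4 * (?N + 1)" by presburger
      then have "real (m + 1) \<le> real (4 * (?N + 1))" by (rule of_nat_mono)
      then have "real m + 1 \<le> 4 * (real ?N + 1)"
        by (simp only: of_nat_add of_nat_mult of_nat_1 of_nat_numeral)
      then have "sqrt (real m + 1) \<le> sqrt (4 * (real ?N + 1))" by (rule real_sqrt_le_mono)
      also have "\<dots> = 2 * sqrt (real ?N + 1)" by (subst real_sqrt_mult) simp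
      finally have s: "sqrt (real m + 1) \<le> 2 * sqrt (real ?N + 1)" .
      let ?c = "C * K / core_variance * tail_moment b H"
      have c: "0 \<le> ?c" using n tail_moment_nonneg by (intro mult_nonneg_nonneg) auto
      have "C * tail_moment b H / core_variance * \<bar>y\<bar> / sqrt (real ?N + 1) = ?c * (1 / sqrt (real ?N + 1))"
        using y by simp
      also have "\<dots> \<le> ?c * (2 / sqrt (real m + 1))"
        using s by (intro mult_left_mono[OF _ c]) (simp add: field_simps)
      also have "\<dots> = (2 * (C * K / core_variance)) * tail_moment b H / sqrt (real m + 1)" by simp
      also have "\<dots> \<le> ?D * tail_moment b H / sqrt (real m + 1)"
        using n tail_moment_nonneg by (intro divide_right_mono mult_right_mono) auto
      finally show "C * tail_moment b H / core_variance * \<bar>y\<bar> / sqrt (real ?N + 1)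
        \<le> ?D * tail_moment b H / sqrt (real m + 1)" .
    qed
    finally show "emeasure seq.S {\<omega>. avoids K m y \<omega> \<and> jumps_across H ?l y \<omega>}
      \<le> ennreal (?D * tail_moment b H / sqrt (real m + 1))" .
  qed
qed

end

section \<open>Order statistics and gaps\<close>

lemma order_stat_mono:
  assumes "1 \<le> k" "k \<le> l" "l \<le> n" shows "order_stat s n k \<le> order_stat s n l"
  unfolding order_stat_def using assms by (intro sorted_nth_mono) auto

text \<open>Reduces the measurability of the order statistics to that of a sum of indicator functions.\<close>

lemma order_stat_le_iff:
  assumes "1 \<le> k" "k \<le> n"
  shows "order_stat s n k \<le> t \<longleftrightarrow> real k \<le> (\<Sum>i\<in>{1..n}. if s i \<le> t then 1 else 0)"
proof -
  let ?xs = "map s [1..<Suc n]"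
  let ?ys = "sort ?xs"
  let ?c = "card {i. i < n \<and> ?ys ! i \<le> t}"
  have "?c = length (filter (\<lambda>x. x \<le> t) ?ys)"
    by (simp add: length_filter_conv_card)
  also have "\<dots> = size (filter_mset (\<lambda>x. x \<le> t) (mset ?ys))"
    by (metis mset_filter size_mset)
  also have "mset ?ys = mset ?xs" by simp
  also have "size (filter_mset (\<lambda>x. x \<le> t) (mset ?xs)) = length (filter (\<lambda>x. x \<le> t) ?xs)"
    by (metis mset_filter size_mset)
  also have "\<dots> = length (filter (\<lambda>i. s i \<le> t) [1..<Suc n])"
    by (simp add: filter_map o_def del: upt_Suc)
  also have "\<dots> = card {i\<in>{1..n}. s i \<le> t}"
    by (subst distinct_card[symmetric]) (auto simp del: upt_Suc intro!: arg_cong[where f = card])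
  finally have c: "real ?c = (\<Sum>i\<in>{1..n}. if s i \<le> t then 1 else 0)"
    by (simp add: sum.If_cases Int_def)
  have sorted: "?ys ! i \<le> ?ys ! j" if "i \<le> j" "j < n" for i j
    using that by (intro sorted_nth_mono) auto
  have "?ys ! (k - 1) \<le> t \<longleftrightarrow> k \<le> ?c"
  proof
    assume le: "?ys ! (k - 1) \<le> t"
    have "{..<k} \<subseteq> {i. i < n \<and> ?ys ! i \<le> t}"
    proof
      fix i assume "i \<in> {..<k}"
      then have "i \<le> k - 1" "k - 1 < n" using assms by auto
      then show "i \<in> {i. i < n \<and> ?ys ! i \<le> t}" using sorted[of i "k - 1"] le by simp
    qed
    then have "card {..<k} \<le> ?c" by (intro card_mono) auto
    then show "k \<le> ?c" by simp
  next
    assume k: "k \<le> ?c"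
    show "?ys ! (k - 1) \<le> t"
    proof (rule ccontr)
      assume gt: "\<not> ?ys ! (k - 1) \<le> t"
      have "{i. i < n \<and> ?ys ! i \<le> t} \<subseteq> {..<k - 1}"
      proof
        fix i assume i: "i \<in> {i. i < n \<and> ?ys ! i \<le> t}"
        show "i \<in> {..<k - 1}"
        proof (rule ccontr)
          assume "i \<notin> {..<k - 1}"
          then have "?ys ! (k - 1) \<le> ?ys ! i" using i by (intro sorted) auto
          then have "?ys ! (k - 1) \<le> t" using i by (blast intro: order_trans)
          then show False using gt by blast
        qed
      qed
      then have "?c \<le> card {..<k - 1}" by (intro card_mono) auto
      then show False using k assms by simp
    qed
  qed
  then show ?thesis unfolding order_stat_def c[symmetric] by simp
qed

lemma measurable_largest_gap:
  assumes "\<And>k. 1 \<le> k \<Longrightarrow> (\<lambda>\<omega>. s k \<omega>) \<in> borel_measurable M"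
  shows "(\<lambda>\<omega>. largest_gap (\<lambda>k. s k \<omega>) n) \<in> borel_measurable M"
proof -
  have os: "(\<lambda>\<omega>. order_stat (\<lambda>k. s k \<omega>) n k) \<in> borel_measurable M" if "1 \<le> k" "k \<le> n" for k
  proof (rule borel_measurableI_le)
    fix t
    have "(\<lambda>\<omega>. \<Sum>i\<in>{1..n}. if s i \<omega> \<le> t then 1 else (0::real)) \<in> borel_measurable M"
    proof (rule borel_measurable_sum)
      fix i assume "i \<in> {1..n}"
      then have [measurable]: "(\<lambda>\<omega>. s i \<omega>) \<in> borel_measurable M" using assms by simp
      show "(\<lambda>\<omega>. if s i \<omega> \<le> t then 1 else (0::real)) \<in> borel_measurable M" by measurable
    qed
    note [measurable] = this
    show "{\<omega> \<in> space M. order_stat (\<lambda>k. s k \<omega>) n k \<le> t} \<in> sets M"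
      unfolding order_stat_le_iff[OF that] by measurable
  qed
  show ?thesis
  proof (cases "n \<le> 1")
    case False
    have "(\<lambda>\<omega>. Max ((\<lambda>k. order_stat (\<lambda>k. s k \<omega>) n (k + 1) - order_stat (\<lambda>k. s k \<omega>) n k) ` {1..n - 1}))
        \<in> borel_measurable M"
      using os by (intro borel_measurable_Max borel_measurable_diff) auto
    then show ?thesis using False by (simp add: largest_gap_def)
  qed (simp add: largest_gap_def)
qed

lemma largest_gap_nonneg: "0 \<le> largest_gap s n"
proof (cases "n \<le> 1")
  case False
  let ?A = "(\<lambda>k. order_stat s n (k + 1) - order_stat s n k) ` {1..n - 1}"
  have "order_stat s n (1 + 1) - order_stat s n 1 \<in> ?A" using False by (intro imageI) auto
  then have "order_stat s n (1 + 1) - order_stat s n 1 \<le> Max ?A" by (intro Max_ge) auto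
  moreover have "order_stat s n 1 \<le> order_stat s n (1 + 1)" using False by (intro order_stat_mono) auto
  moreover have "largest_gap s n = Max ?A" unfolding largest_gap_def by (rule if_not_P[OF False])
  ultimately show ?thesis by linarith
qed (simp add: largest_gap_def)

lemma largest_gap_endpoints:
  assumes "H < largest_gap s n" "0 \<le> H"
  obtains i j where "i \<in> {1..n}" "j \<in> {1..n}" "H < s j - s i"
    "\<And>l. l \<in> {1..n} \<Longrightarrow> s l \<le> s i \<or> s j \<le> s l"
proof -
  have n: "1 < n" using assms by (auto simp: largest_gap_def split: if_splits)
  let ?A = "(\<lambda>k. order_stat s n (k + 1) - order_stat s n k) ` {1..n - 1}"
  have "largest_gap s n = Max ?A" unfolding largest_gap_def using n by (intro if_not_P) simp
  moreover have "Max ?A \<in> ?A" using n by (intro Max_in) auto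
  ultimately obtain k where k: "k \<in> {1..n - 1}" "H < order_stat s n (k + 1) - order_stat s n k"
    using assms(1) by (metis (no_types, lifting) imageE)
  let ?ys = "sort (map s [1..<Suc n])"
  have len: "length ?ys = n" by simp
  have mem: "set ?ys = s ` {1..n}" by (auto simp del: upt_Suc)
  have "?ys ! (k - 1) \<in> s ` {1..n}" "?ys ! k \<in> s ` {1..n}"
    using k n mem nth_mem[of "k - 1" ?ys] nth_mem[of k ?ys] len by auto
  then obtain i j where ij: "i \<in> {1..n}" "s i = ?ys ! (k - 1)" "j \<in> {1..n}" "s j = ?ys ! k"
    by (metis imageE)
  have "s l \<le> s i \<or> s j \<le> s l" if "l \<in> {1..n}" for l
  proof -
    have "s l \<in> set ?ys" using that mem by blast
    then obtain p where p: "p < n" "?ys ! p = s l" using len by (metis in_set_conv_nth)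
    show ?thesis
    proof (cases "p \<le> k - 1")
      case True
      then have "?ys ! p \<le> ?ys ! (k - 1)" using k n by (intro sorted_nth_mono) auto
      then show ?thesis using p ij by simp
    next
      case False
      then have "?ys ! k \<le> ?ys ! p" using p by (intro sorted_nth_mono) auto
      then show ?thesis using p ij by simp
    qed
  qed
  moreover have "H < s j - s i" using k(2) ij by (simp add: order_stat_def)
  ultimately show ?thesis using that ij by blast
qed

section \<open>The walk seen from an endpoint\<close>

definition partial_sum :: "(nat \<Rightarrow> real) \<Rightarrow> nat \<Rightarrow> real" where
  "partial_sum x k = (\<Sum>i = 1..k. x i)"

lemma partial_sum_Suc: "partial_sum x (Suc k) = partial_sum x k + x (Suc k)"
  by (simp add: partial_sum_def)

lemma walk_from_forward:
  "walk_from y (\<lambda>t. x (t + i + 1)) j = y + (partial_sum x (i + j) - partial_sum x i)"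
  by (induction j) (auto simp: walk_from_Suc partial_sum_Suc add.commute)

lemma walk_from_backward:
  "j \<le> i \<Longrightarrow> walk_from y (\<lambda>t. x (i - t)) j = y + (partial_sum x i - partial_sum x (i - j))"
proof (induction j)
  case (Suc j)
  then have "i - j = Suc (i - Suc j)" by simp
  then show ?case using Suc partial_sum_Suc[of x "i - Suc j"] by (simp add: walk_from_Suc)
qed simp

lemma jumps_across_mono: "jumps_across H l y \<omega> \<Longrightarrow> l \<le> l' \<Longrightarrow> jumps_across H l' y \<omega>"
  unfolding jumps_across_def by (meson order_less_le_trans)

lemma walk_from_uminus: "walk_from (- y) (\<lambda>t. - \<omega> t) j = - walk_from y \<omega> j"
  by (simp add: walk_from_def sum_negf)

lemma jumps_across_uminus: "jumps_across H l (- y) (\<lambda>t. - \<omega> t) = jumps_across H l y \<omega>"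
  by (simp add: jumps_across_def walk_from_uminus)

text \<open>Between a visit of the lower endpoint at time \<open>i\<close> and a visit of the upper one at time \<open>j\<close> there is a
  jump across the gap. It happens within the first half of the forward walk from \<open>i\<close> to \<open>j\<close> or
  within the first half of the walk run backwards from \<open>j\<close> to \<open>i\<close>. The starting point \<open>- K\<close> puts the origin at
  distance \<open>K\<close> inside the gap.\<close>

lemma jump_near_endpoint:
  assumes K: "0 \<le> K" "2 * K \<le> H" and ij: "1 \<le> i" "i < j"
    and gap: "H < partial_sum x j - partial_sum x i"
    and out: "\<And>l. i \<le> l \<Longrightarrow> l \<le> j \<Longrightarrow> partial_sum x l \<le> partial_sum x i \<or> partial_sum x j \<le> partial_sum x l"
  shows "jumps_across H ((j - i + 1) div 2) (- K) (\<lambda>t. x (t + i + 1))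
    \<or> jumps_across H ((j - i + 1) div 2) (- K) (\<lambda>t. x (j - t))"
proof -
  let ?s = "partial_sum x"
  \<comment> \<open>The first arrival at or above the upper endpoint is a jump from a place at or below the lower one.\<close>
  define k where "k = (LEAST k. i < k \<and> ?s j \<le> ?s k)"
  have k: "i < k" "?s j \<le> ?s k" and kj: "k \<le> j"
    unfolding k_def using LeastI[of "\<lambda>k. i < k \<and> ?s j \<le> ?s k" j] Least_le[of "\<lambda>k. i < k \<and> ?s j \<le> ?s k" j] ij
    by auto
  obtain p where p: "k = Suc p" using k(1) by (cases k) auto
  have sp: "?s p \<le> ?s i"
  proof (cases "p = i")
    case False
    then have "i < p" using k p by simp
    then have "\<not> ?s j \<le> ?s p" using not_less_Least[of p "\<lambda>k. i < k \<and> ?s j \<le> ?s k"] p by (auto simp: k_def)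
    then show ?thesis using out[of p] \<open>i < p\<close> p kj by auto
  qed simp
  have xk: "H \<le> \<bar>x k\<bar>" using gap k(2) sp partial_sum_Suc[of x p] p by simp
  let ?l = "(j - i + 1) div 2"
  consider "k - i \<le> ?l" | "j - k + 1 \<le> ?l" using k(1) kj by linarith
  then show ?thesis
  proof cases
    case 1
    have "walk_from (- K) (\<lambda>t. x (t + i + 1)) (p - i) \<le> 0"
      using sp K k p unfolding walk_from_forward by simp
    moreover have "0 \<le> walk_from (- K) (\<lambda>t. x (t + i + 1)) (Suc (p - i))"
      using sp K k p gap unfolding walk_from_forward by simp
    moreover have "p - i < ?l" "p - i + i + 1 = k" using 1 p k by auto
    ultimately show ?thesis using xk unfolding jumps_across_def by (metis mult_nonpos_nonneg)
  next
    case 2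
    have "walk_from (- K) (\<lambda>t. x (j - t)) (j - k) \<le> 0"
      using K k kj by (simp add: walk_from_backward)
    moreover have "j - Suc (j - k) = p" using p kj by simp
    then have "0 \<le> walk_from (- K) (\<lambda>t. x (j - t)) (Suc (j - k))"
      using sp K k kj p gap ij by (subst walk_from_backward) auto
    moreover have "j - k < ?l" "j - (j - k) = k" using 2 kj by auto
    ultimately show ?thesis using xk unfolding jumps_across_def by (metis mult_nonpos_nonneg)
  qed
qed

text \<open>The sign of \<open>y\<close> tells whether the walk is observed from the lower or from the upper endpoint.
  If the upper endpoint is visited first, \<open>jump_near_endpoint\<close> applies to the reflected walk.\<close>

lemma gap_seen_from_endpoint:
  assumes K: "0 \<le> K" "2 * K \<le> H" and ij: "i \<in> {1..n}" "j \<in> {1..n}"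
    and gap: "H < partial_sum x j - partial_sum x i"
    and out: "\<And>l. l \<in> {1..n} \<Longrightarrow> partial_sum x l \<le> partial_sum x i \<or> partial_sum x j \<le> partial_sum x l"
  shows "\<exists>k\<in>{1..n}. \<exists>y\<in>{K, - K}.
    avoids K (k - 1) y (\<lambda>t. x (k - t)) \<and> avoids K (n - k) (- y) (\<lambda>t. x (t + k + 1)) \<and>
    (jumps_across H ((n - k + 1) div 2) (- y) (\<lambda>t. x (t + k + 1))
      \<or> jumps_across H ((k - 1 + 1) div 2) y (\<lambda>t. x (k - t)))"
proof -
  let ?s = "partial_sum x"
  let ?J = "\<lambda>k y. jumps_across H ((n - k + 1) div 2) (- y) (\<lambda>t. x (t + k + 1))
      \<or> jumps_across H ((k - 1 + 1) div 2) y (\<lambda>t. x (k - t))"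
  have low_back: "avoids K (i - 1) K (\<lambda>t. x (i - t))"
    unfolding avoids_def
  proof
    fix t assume t: "t \<in> {1..i - 1}"
    then have "i - t \<in> {1..n}" using ij by auto
    with t show "K \<le> \<bar>walk_from K (\<lambda>t. x (i - t)) t\<bar>"
      using out[of "i - t"] gap K by (auto simp: walk_from_backward)
  qed
  have low_fwd: "avoids K (n - i) (- K) (\<lambda>t. x (t + i + 1))"
    unfolding avoids_def
  proof
    fix t assume "t \<in> {1..n - i}"
    then have "i + t \<in> {1..n}" using ij by auto
    then show "K \<le> \<bar>walk_from (- K) (\<lambda>t. x (t + i + 1)) t\<bar>"
      using out[of "i + t"] gap K unfolding walk_from_forward by auto
  qed
  have up_back: "avoids K (j - 1) (- K) (\<lambda>t. x (j - t))"
    unfolding avoids_def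
  proof
    fix t assume t: "t \<in> {1..j - 1}"
    then have "j - t \<in> {1..n}" using ij by auto
    with t show "K \<le> \<bar>walk_from (- K) (\<lambda>t. x (j - t)) t\<bar>"
      using out[of "j - t"] gap K by (auto simp: walk_from_backward)
  qed
  have up_fwd: "avoids K (n - j) (- (- K)) (\<lambda>t. x (t + j + 1))"
    unfolding avoids_def
  proof
    fix t assume "t \<in> {1..n - j}"
    then have "j + t \<in> {1..n}" using ij by auto
    then show "K \<le> \<bar>walk_from (- (- K)) (\<lambda>t. x (t + j + 1)) t\<bar>"
      using out[of "j + t"] gap K unfolding walk_from_forward by auto
  qed
  have "?J i K \<or> ?J j (- K)"
  proof (cases i j rule: linorder_cases)
    case less
    have "jumps_across H ((j - i + 1) div 2) (- K) (\<lambda>t. x (t + i + 1))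
      \<or> jumps_across H ((j - i + 1) div 2) (- K) (\<lambda>t. x (j - t))"
      using less ij by (intro jump_near_endpoint K gap out) auto
    moreover have "(j - i + 1) div 2 \<le> (n - i + 1) div 2" "(j - i + 1) div 2 \<le> (j - 1 + 1) div 2"
      using ij by (auto intro!: div_le_mono)
    ultimately show ?thesis using jumps_across_mono by blast
  next
    case greater
    have neg: "partial_sum (\<lambda>l. - x l) l = - ?s l" for l by (simp add: partial_sum_def sum_negf)
    have "jumps_across H ((i - j + 1) div 2) (- K) (\<lambda>t. - x (t + j + 1))
      \<or> jumps_across H ((i - j + 1) div 2) (- K) (\<lambda>t. - x (i - t))"
    proof (rule jump_near_endpoint[where x = "\<lambda>l. - x l"])
      show "partial_sum (\<lambda>l. - x l) l \<le> partial_sum (\<lambda>l. - x l) j \<or> partial_sum (\<lambda>l. - x l) i \<le> partial_sum (\<lambda>l. - x l) l"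
        if "j \<le> l" "l \<le> i" for l using out[of l] that ij by (auto simp: neg)
    qed (use greater ij K gap in \<open>auto simp: neg\<close>)
    then have "jumps_across H ((i - j + 1) div 2) K (\<lambda>t. x (t + j + 1))
      \<or> jumps_across H ((i - j + 1) div 2) K (\<lambda>t. x (i - t))"
      by (simp only: jumps_across_uminus)
    moreover have "(i - j + 1) div 2 \<le> (n - j + 1) div 2" "(i - j + 1) div 2 \<le> (i - 1 + 1) div 2"
      using ij by (auto intro!: div_le_mono)
    ultimately show ?thesis using jumps_across_mono unfolding minus_minus by blast
  next
    case equal
    then show ?thesis using gap K by simp
  qed
  then show ?thesis
  proof
    assume "?J i K"
    then show ?thesis using low_back low_fwd ij by blast
  next
    assume "?J j (- K)"
    then show ?thesis using up_back up_fwd ij by blast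
  qed
qed

section \<open>Summation over the endpoints\<close>

lemma sum_inverse_sqrt_le: "(\<Sum>i = 1..n. 1 / sqrt (real i)) \<le> 2 * sqrt (real n)"
proof (induction n)
  case (Suc n)
  have "1 / sqrt (real (Suc n)) \<le> 2 * sqrt (real (Suc n)) - 2 * sqrt (real n)"
  proof -
    let ?a = "sqrt (real (Suc n))" and ?b = "sqrt (real n)"
    have a: "0 < ?a" by simp
    have "0 \<le> (?a - ?b)\<^sup>2" by simp
    also have "\<dots> = ?a\<^sup>2 + ?b\<^sup>2 - 2 * ?a * ?b" by (rule power2_diff)
    also have "?b\<^sup>2 = ?a\<^sup>2 - 1" by simp
    finally have "1 \<le> (2 * ?a - 2 * ?b) * ?a" by (simp add: power2_eq_square algebra_simps)
    then show ?thesis using a by (simp add: divide_le_eq)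
  qed
  then show ?case using Suc by simp
qed simp

text \<open>From \<open>sqrt (n + 1) \<le> sqrt k + sqrt (n - k + 1)\<close> the summand is at most
  \<open>(1 / sqrt k + 1 / sqrt (n - k + 1)) / sqrt (n + 1)\<close>, and the sums of inverse square roots grow like \<open>sqrt n\<close>.\<close>

lemma sum_inverse_sqrt_product_le:
  "(\<Sum>i = 1..n. 1 / (sqrt (real i) * sqrt (real (n - i) + 1))) \<le> 4"
proof -
  let ?r = "sqrt (real n + 1)"
  have r: "0 < ?r" by simp
  have "(\<Sum>i = 1..n. 1 / (sqrt (real i) * sqrt (real (n - i) + 1)))
      \<le> (\<Sum>i = 1..n. (1 / sqrt (real i) + 1 / sqrt (real (n - i) + 1)) / ?r)"
  proof (rule sum_mono)
    fix i assume i: "i \<in> {1..n}"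
    let ?a = "sqrt (real i)" and ?b = "sqrt (real (n - i) + 1)"
    have ab: "0 < ?a" "0 < ?b" using i by auto
    have "?r = sqrt (real i + (real (n - i) + 1))" using i by (simp add: of_nat_diff)
    also have "\<dots> \<le> ?a + ?b" by (rule sqrt_add_le_add_sqrt) auto
    finally have "1 \<le> (?a + ?b) / ?r" using r by simp
    then have "1 / (?a * ?b) \<le> (?a + ?b) / ?r / (?a * ?b)"
      using ab by (intro divide_right_mono) auto
    also have "\<dots> = (1 / ?a + 1 / ?b) / ?r" using ab r by (simp add: field_simps)
    finally show "1 / (?a * ?b) \<le> (1 / ?a + 1 / ?b) / ?r" .
  qed
  also have "\<dots> = ((\<Sum>i = 1..n. 1 / sqrt (real i)) + (\<Sum>i = 1..n. 1 / sqrt (real (n - i) + 1))) / ?r"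
    by (simp add: sum.distrib sum_divide_distrib[symmetric])
  also have "(\<Sum>i = 1..n. 1 / sqrt (real (n - i) + 1)) = (\<Sum>i = 1..n. 1 / sqrt (real i))"
    by (rule sum.reindex_bij_witness[of _ "\<lambda>i. n + 1 - i" "\<lambda>i. n + 1 - i"]) (auto simp: of_nat_diff)
  also have "((\<Sum>i = 1..n. 1 / sqrt (real i)) + (\<Sum>i = 1..n. 1 / sqrt (real i))) / ?r
      \<le> (4 * sqrt (real n)) / ?r"
    using sum_inverse_sqrt_le[of n] by (intro divide_right_mono) auto
  also have "\<dots> \<le> 4"
  proof -
    have "4 * sqrt (real n) \<le> 4 * ?r" by simp
    then show ?thesis using r by (simp only: pos_divide_le_eq)
  qed
  finally show ?thesis .
qed

lemma (in prob_space) distr_iid_sequence: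
  fixes X :: "nat \<Rightarrow> 'a \<Rightarrow> real"
  assumes indep: "indep_vars (\<lambda>_. borel) X {1..}"
    and ident: "\<And>i. i \<ge> 1 \<Longrightarrow> distr M borel (X i) = distr M borel (X 1)"
    and \<nu>: "inj \<nu>" "\<And>t. 1 \<le> \<nu> t"
  shows "distr M (\<Pi>\<^sub>M t\<in>UNIV. distr M borel (X 1)) (\<lambda>\<omega> t. X (\<nu> t) \<omega>)
    = (\<Pi>\<^sub>M t\<in>UNIV. distr M borel (X 1))"
proof -
  let ?\<mu> = "distr M borel (X 1)" and ?I = "{1..} :: nat set"
  have rv: "random_variable borel (X i)" if "i \<in> ?I" for i
    using indep that by (auto simp: indep_vars_def)
  interpret law: prob_space ?\<mu> using rv[of 1] by (intro prob_space_distr) simp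
  have sets: "sets (\<Pi>\<^sub>M i\<in>I. ?\<mu>) = sets (\<Pi>\<^sub>M i\<in>I. borel)" for I :: "nat set"
    by (intro sets_PiM_cong) auto
  have "distr M (\<Pi>\<^sub>M i\<in>?I. borel) (\<lambda>\<omega>. \<lambda>i\<in>?I. X i \<omega>) = (\<Pi>\<^sub>M i\<in>?I. distr M borel (X i))"
    using indep_vars_iff_distr_eq_PiM'[where M' = "\<lambda>_. borel" and X = X and I = ?I] rv indep by auto
  also have "\<dots> = (\<Pi>\<^sub>M i\<in>?I. ?\<mu>)" by (intro PiM_cong refl ident) simp
  finally have joint: "distr M (\<Pi>\<^sub>M i\<in>?I. ?\<mu>) (\<lambda>\<omega>. \<lambda>i\<in>?I. X i \<omega>) = (\<Pi>\<^sub>M i\<in>?I. ?\<mu>)"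
    by (simp only: distr_cong[OF refl sets refl])
  have m1: "(\<lambda>\<omega>. \<lambda>i\<in>?I. X i \<omega>) \<in> measurable M (\<Pi>\<^sub>M i\<in>?I. ?\<mu>)"
    using rv by (intro measurable_restrict) auto
  have m2: "(\<lambda>x. \<lambda>t\<in>UNIV. x (\<nu> t)) \<in> measurable (\<Pi>\<^sub>M i\<in>?I. ?\<mu>) (\<Pi>\<^sub>M t\<in>UNIV. ?\<mu>)"
    using \<nu>(2) by (intro measurable_restrict measurable_component_singleton) auto
  have "(\<Pi>\<^sub>M t\<in>UNIV. ?\<mu>) = distr (\<Pi>\<^sub>M i\<in>?I. ?\<mu>) (\<Pi>\<^sub>M t\<in>UNIV. ?\<mu>) (\<lambda>x. \<lambda>t\<in>UNIV. x (\<nu> t))"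
    using \<nu> by (intro distr_PiM_reindex[symmetric] law.prob_space_axioms) auto
  also have "\<dots> = distr (distr M (\<Pi>\<^sub>M i\<in>?I. ?\<mu>) (\<lambda>\<omega>. \<lambda>i\<in>?I. X i \<omega>)) (\<Pi>\<^sub>M t\<in>UNIV. ?\<mu>) (\<lambda>x. \<lambda>t\<in>UNIV. x (\<nu> t))"
    by (simp only: joint)
  also have "\<dots> = distr M (\<Pi>\<^sub>M t\<in>UNIV. ?\<mu>) ((\<lambda>x. \<lambda>t\<in>UNIV. x (\<nu> t)) \<circ> (\<lambda>\<omega>. \<lambda>i\<in>?I. X i \<omega>))"
    by (rule distr_distr[OF m2 m1])
  also have "(\<lambda>x. \<lambda>t\<in>UNIV. x (\<nu> t)) \<circ> (\<lambda>\<omega>. \<lambda>i\<in>?I. X i \<omega>) = (\<lambda>\<omega> t. X (\<nu> t) \<omega>)"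
    using \<nu>(2) by (auto simp: fun_eq_iff)
  finally show ?thesis by (rule sym)
qed

text \<open>A relabelling of the increments as seen at time \<open>k\<close>: first \<open>k, k - 1, \<dots>, 2\<close>, which drive the walk
  backwards to time \<open>1\<close>, and then \<open>k + 1, k + 2, \<dots>\<close>, which drive it forwards. The value
  \<open>t + 2\<close> is \<open>k + 1 + (t - (k - 1))\<close>.\<close>

definition unfold_at :: "nat \<Rightarrow> nat \<Rightarrow> nat" where
  "unfold_at k t = (if t < k - 1 then k - t else t + 2)"

lemma inj_unfold_at: "inj (unfold_at k)"
  by (rule injI) (auto simp: unfold_at_def split: if_splits)

lemma unfold_at_ge_1: "1 \<le> unfold_at k t"
  by (auto simp: unfold_at_def)

lemma unfold_at_shift: "1 \<le> k \<Longrightarrow> unfold_at k (t + (k - 1)) = t + k + 1"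
  by (simp add: unfold_at_def)

context avoiding_walk
begin

text \<open>The event of \<open>gap_seen_from_endpoint\<close> in terms of the relabelled increments: the first
  \<open>k - 1\<close> of them are the reversed past and the others are the future. The reversed walk adds the increments instead of
  subtracting them, and this is why the past starts at \<open>y\<close> and the future at \<open>- y\<close>.\<close>

definition gap_event :: "real \<Rightarrow> nat \<Rightarrow> nat \<Rightarrow> real \<Rightarrow> (nat \<Rightarrow> real) \<Rightarrow> bool" where
  "gap_event H n k y \<omega> \<longleftrightarrow>
    avoids K (k - 1) y \<omega> \<and> avoids K (n - k) (- y) (\<lambda>t. \<omega> (t + (k - 1))) \<and>
    (jumps_across H ((n - k + 1) div 2) (- y) (\<lambda>t. \<omega> (t + (k - 1)))
      \<or> jumps_across H ((k - 1 + 1) div 2) y \<omega>)"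

lemma gap_event_of_gap:
  assumes "2 * K \<le> H" "H < largest_gap (partial_sum x) n"
  shows "\<exists>k\<in>{1..n}. \<exists>y\<in>{K, - K}. gap_event H n k y (\<lambda>t. x (unfold_at k t))"
proof -
  have K: "0 \<le> K" "0 \<le> H" using K_pos assms(1) by auto
  obtain i j where ij: "i \<in> {1..n}" "j \<in> {1..n}" "H < partial_sum x j - partial_sum x i"
    "\<And>l. l \<in> {1..n} \<Longrightarrow> partial_sum x l \<le> partial_sum x i \<or> partial_sum x j \<le> partial_sum x l"
    using largest_gap_endpoints[OF assms(2) K(2)] by blast
  obtain k y where k: "k \<in> {1..n}" and y: "y \<in> {K, - K}"
    and ev: "avoids K (k - 1) y (\<lambda>t. x (k - t))" "avoids K (n - k) (- y) (\<lambda>t. x (t + k + 1))"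
      "jumps_across H ((n - k + 1) div 2) (- y) (\<lambda>t. x (t + k + 1))
        \<or> jumps_across H ((k - 1 + 1) div 2) y (\<lambda>t. x (k - t))"
    using gap_seen_from_endpoint[OF K(1) assms(1) ij] by blast
  have shift: "(\<lambda>t. x (unfold_at k (t + (k - 1)))) = (\<lambda>t. x (t + k + 1))"
    using k by (simp only: unfold_at_shift atLeastAtMost_iff)
  have pre: "x (unfold_at k t) = x (k - t)" if "t < k - 1" for t
    using that by (simp add: unfold_at_def)
  have a: "avoids K (k - 1) y (\<lambda>t. x (unfold_at k t)) = avoids K (k - 1) y (\<lambda>t. x (k - t))"
    using pre by (rule avoids_cong)
  have j: "jumps_across H ((k - 1 + 1) div 2) y (\<lambda>t. x (unfold_at k t))
      = jumps_across H ((k - 1 + 1) div 2) y (\<lambda>t. x (k - t))" if "2 \<le> k"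
    using pre that by (intro jumps_across_cong) auto
  \<comment> \<open>For \<open>k = 1\<close> there is no past, and no step of it in which a jump could occur.\<close>
  have j1: "(k - 1 + 1) div 2 = 0" if "\<not> 2 \<le> k" using that k by auto
  have "gap_event H n k y (\<lambda>t. x (unfold_at k t))"
    unfolding gap_event_def shift a using ev j j1
    by (cases "2 \<le> k") (auto simp: jumps_across_def)
  then show ?thesis using k y by blast
qed

lemma measurable_gap_event [measurable]: "Measurable.pred seq.S (gap_event H n k y)"
proof -
  have [measurable]: "(\<lambda>\<omega> t. \<omega> (t + (k - 1))) \<in> measurable seq.S seq.S"
    by (rule measurable_PiM_single') (auto intro: measurable_component_singleton)
  show ?thesis unfolding gap_event_def[abs_def] by measurable
qed

text \<open>Past and future are independent. Both avoid the interval, at the cost of one factor \<open>C / sqrt m\<close>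
  each, and in one of them the required jump replaces \<open>C\<close> by the small constant \<open>e\<close>.\<close>

lemma emeasure_gap_event_le:
  assumes C: "0 \<le> C"
    "\<And>m y. \<bar>y\<bar> = K \<Longrightarrow> emeasure seq.S {\<omega>. avoids K m y \<omega>} \<le> ennreal (C / sqrt (real m + 1))"
    "\<And>m y. \<bar>y\<bar> = K \<Longrightarrow>
      emeasure seq.S {\<omega>. avoids K m y \<omega> \<and> jumps_across H ((m + 1) div 2) y \<omega>}
        \<le> ennreal (e / sqrt (real m + 1))"
    and e: "0 \<le> e" and y: "\<bar>y\<bar> = K" and k: "k \<in> {1..n}"
  shows "emeasure seq.S {\<omega>. gap_event H n k y \<omega>}
    \<le> ennreal (2 * C * e * (1 / (sqrt (real k) * sqrt (real (n - k) + 1))))"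
proof -
  let ?sh = "\<lambda>\<omega> t. \<omega> (t + (k - 1))"
  let ?A = "avoids K (k - 1) y" and ?B = "avoids K (n - k) (- y)"
  let ?AJ = "\<lambda>\<omega>. avoids K (k - 1) y \<omega> \<and> jumps_across H ((k - 1 + 1) div 2) y \<omega>"
  let ?BJ = "\<lambda>\<omega>. avoids K (n - k) (- y) \<omega> \<and> jumps_across H ((n - k + 1) div 2) (- y) \<omega>"
  have [measurable]: "?sh \<in> measurable seq.S seq.S"
    by (rule measurable_PiM_single') (auto intro: measurable_component_singleton)
  have preA: "?A \<omega> = ?A \<omega>'" if "\<And>t. t < k - 1 \<Longrightarrow> \<omega> t = \<omega>' t" for \<omega> \<omega>' :: "nat \<Rightarrow> real"
    using that by (rule avoids_cong)
  have preAJ: "?AJ \<omega> = ?AJ \<omega>'" if *: "\<And>t. t < k - 1 \<Longrightarrow> \<omega> t = \<omega>' t" for \<omega> \<omega>' :: "nat \<Rightarrow> real"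
  proof -
    have "t < k - 1" if "t < (k - 1 + 1) div 2" for t using that by linarith
    then have "jumps_across H ((k - 1 + 1) div 2) y \<omega> = jumps_across H ((k - 1 + 1) div 2) y \<omega>'"
      using * by (intro jumps_across_cong) blast
    moreover have "?A \<omega> = ?A \<omega>'" using * by (rule preA)
    ultimately show ?thesis by blast
  qed
  have y': "\<bar>- y\<bar> = K" using y by simp
  have kk: "real (k - 1) + 1 = real k" using k by (simp add: of_nat_diff)
  have s1: "emeasure seq.S {\<omega>. ?A \<omega> \<and> ?BJ (?sh \<omega>)}
      = emeasure seq.S {\<omega>. ?A \<omega>} * emeasure seq.S {\<omega>. ?BJ \<omega>}"
    by (rule emeasure_split[OF _ _ preA]) measurable
  have s2: "emeasure seq.S {\<omega>. ?AJ \<omega> \<and> ?B (?sh \<omega>)}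
      = emeasure seq.S {\<omega>. ?AJ \<omega>} * emeasure seq.S {\<omega>. ?B \<omega>}"
    by (rule emeasure_split[OF _ _ preAJ]) measurable
  have m1: "{\<omega>. ?A \<omega> \<and> ?BJ (?sh \<omega>)} \<in> sets seq.S"
  proof -
    have "Measurable.pred seq.S (\<lambda>\<omega>. ?A \<omega> \<and> ?BJ (?sh \<omega>))" by measurable
    from predE[OF this] show ?thesis by simp
  qed
  have m2: "{\<omega>. ?AJ \<omega> \<and> ?B (?sh \<omega>)} \<in> sets seq.S"
  proof -
    have "Measurable.pred seq.S (\<lambda>\<omega>. ?AJ \<omega> \<and> ?B (?sh \<omega>))" by measurable
    from predE[OF this] show ?thesis by simp
  qed
  have "{\<omega>. gap_event H n k y \<omega>} = {\<omega>. ?A \<omega> \<and> ?BJ (?sh \<omega>)} \<union> {\<omega>. ?AJ \<omega> \<and> ?B (?sh \<omega>)}"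
    by (auto simp: gap_event_def)
  then have "emeasure seq.S {\<omega>. gap_event H n k y \<omega>}
      \<le> emeasure seq.S {\<omega>. ?A \<omega> \<and> ?BJ (?sh \<omega>)} + emeasure seq.S {\<omega>. ?AJ \<omega> \<and> ?B (?sh \<omega>)}"
    using emeasure_subadditive[OF m1 m2] by simp
  also have "\<dots> \<le> ennreal (C / sqrt (real (k - 1) + 1)) * ennreal (e / sqrt (real (n - k) + 1))
      + ennreal (e / sqrt (real (k - 1) + 1)) * ennreal (C / sqrt (real (n - k) + 1))"
    unfolding s1 s2 by (intro add_mono mult_mono C(2,3) y y') auto
  also have "\<dots> = ennreal (2 * C * e * (1 / (sqrt (real k) * sqrt (real (n - k) + 1))))"
    unfolding kk using C(1) e
    by (simp add: ennreal_mult'[symmetric] ennreal_plus[symmetric] mult_ac del: ennreal_plus)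
  finally show ?thesis .
qed

lemma gap_tail_le:
  assumes C: "0 \<le> C"
    "\<And>m y. \<bar>y\<bar> = K \<Longrightarrow> emeasure seq.S {\<omega>. avoids K m y \<omega>} \<le> ennreal (C / sqrt (real m + 1))"
    "\<And>m y. \<bar>y\<bar> = K \<Longrightarrow>
      emeasure seq.S {\<omega>. avoids K m y \<omega> \<and> jumps_across H ((m + 1) div 2) y \<omega>}
        \<le> ennreal (e / sqrt (real m + 1))"
    and e: "0 \<le> e" and H: "2 * K \<le> H"
    and X: "\<And>i. 1 \<le> i \<Longrightarrow> X i \<in> borel_measurable M"
    and law: "\<And>\<nu>. inj \<nu> \<Longrightarrow> (\<And>t. 1 \<le> \<nu> t) \<Longrightarrow> distr M seq.S (\<lambda>\<omega> t. X (\<nu> t) \<omega>) = seq.S"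
  shows "emeasure M {\<omega> \<in> space M. H < walk_gap X n \<omega>} \<le> ennreal (16 * C * e)"
proof -
  let ?E = "\<lambda>k y. {\<omega> \<in> space M. gap_event H n k y (\<lambda>t. X (unfold_at k t) \<omega>)}"
  have meas: "(\<lambda>\<omega> t. X (unfold_at k t) \<omega>) \<in> measurable M seq.S" for k
    using X[OF unfold_at_ge_1] by (intro measurable_PiM_single') (auto simp: sets_law cong: measurable_cong_sets)
  have E: "?E k y \<in> sets M" for k y
    using measurable_compose[OF meas measurable_gap_event[where H = H and n = n and k = k and y = y]] by (rule predE)
  have "{\<omega> \<in> space M. H < walk_gap X n \<omega>} \<subseteq> (\<Union>k\<in>{1..n}. ?E k K \<union> ?E k (- K))"
  proof
    fix \<omega> assume \<omega>: "\<omega> \<in> {\<omega> \<in> space M. H < walk_gap X n \<omega>}"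
    have "(\<lambda>k. random_walk X k \<omega>) = partial_sum (\<lambda>i. X i \<omega>)"
      by (simp add: random_walk_def partial_sum_def fun_eq_iff)
    then have "H < largest_gap (partial_sum (\<lambda>i. X i \<omega>)) n" using \<omega> by (simp add: walk_gap_def)
    from gap_event_of_gap[OF H this] \<omega> show "\<omega> \<in> (\<Union>k\<in>{1..n}. ?E k K \<union> ?E k (- K))" by auto
  qed
  then have "emeasure M {\<omega> \<in> space M. H < walk_gap X n \<omega>} \<le> emeasure M (\<Union>k\<in>{1..n}. ?E k K \<union> ?E k (- K))"
    using E by (intro emeasure_mono) auto
  also have "\<dots> \<le> (\<Sum>k\<in>{1..n}. emeasure M (?E k K \<union> ?E k (- K)))"
    using E by (intro emeasure_subadditive_finite) auto
  also have "\<dots> \<le> (\<Sum>k\<in>{1..n}. ennreal (4 * C * e * (1 / (sqrt (real k) * sqrt (real (n - k) + 1)))))"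
  proof (rule sum_mono)
    fix k assume k: "k \<in> {1..n}"
    let ?q = "1 / (sqrt (real k) * sqrt (real (n - k) + 1))"
    have one: "emeasure M (?E k y) \<le> ennreal (2 * C * e * ?q)" if y: "\<bar>y\<bar> = K" for y
    proof -
      have "emeasure seq.S {\<omega>. gap_event H n k y \<omega>} = emeasure (distr M seq.S (\<lambda>\<omega> t. X (unfold_at k t) \<omega>)) {\<omega>. gap_event H n k y \<omega>}"
        by (subst law[OF inj_unfold_at unfold_at_ge_1]) rule
      also have "\<dots> = emeasure M (?E k y)"
        using predE[OF measurable_gap_event[where H = H and n = n and k = k and y = y]]
        by (subst emeasure_distr[OF meas]) (auto intro!: arg_cong[where f = "emeasure M"])
      finally show ?thesis using emeasure_gap_event_le[OF C e y k] by simp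
    qed
    have "emeasure M (?E k K \<union> ?E k (- K)) \<le> emeasure M (?E k K) + emeasure M (?E k (- K))"
      by (rule emeasure_subadditive[OF E E])
    also have "\<dots> \<le> ennreal (2 * C * e * ?q) + ennreal (2 * C * e * ?q)"
      using K_pos by (intro add_mono one) auto
    also have "\<dots> = ennreal (4 * C * e * ?q)"
      using C(1) e by (subst ennreal_plus[symmetric]) auto
    finally show "emeasure M (?E k K \<union> ?E k (- K)) \<le> ennreal (4 * C * e * ?q)" .
  qed
  also have "\<dots> = ennreal (\<Sum>k\<in>{1..n}. 4 * C * e * (1 / (sqrt (real k) * sqrt (real (n - k) + 1))))"
    using C(1) e by (intro sum_ennreal) auto
  also have "\<dots> \<le> ennreal (16 * C * e)"
  proof (rule ennreal_leI)
    have "4 * C * e * (\<Sum>k = 1..n. 1 / (sqrt (real k) * sqrt (real (n - k) + 1))) \<le> 4 * C * e * 4"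
      using C(1) e by (intro mult_left_mono[OF sum_inverse_sqrt_product_le]) auto
    then show "(\<Sum>k\<in>{1..n}. 4 * C * e * (1 / (sqrt (real k) * sqrt (real (n - k) + 1)))) \<le> 16 * C * e"
      by (simp only: sum_distrib_left[symmetric])
  qed
  finally show ?thesis .
qed

end

text \<open>If \<open>X 1\<close> vanishes almost surely, then so does every gap. Otherwise the law of \<open>X 1\<close> has positive variance
  and the bound of \<open>gap_tail_le\<close> tends to zero as \<open>H\<close> grows, uniformly in \<open>n\<close>.\<close>

lemma (in prob_space) walk_gap_uniform_tail:
  fixes X :: "nat \<Rightarrow> 'a \<Rightarrow> real"
  assumes indep: "indep_vars (\<lambda>_. borel) X {1..}"
    and ident: "\<And>i. i \<ge> 1 \<Longrightarrow> distr M borel (X i) = distr M borel (X 1)"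
    and centred: "expectation (X 1) = 0"
    and square: "integrable M (\<lambda>\<omega>. (X 1 \<omega>)\<^sup>2)"
    and \<epsilon>: "0 < \<epsilon>"
  obtains H where "0 \<le> H" "\<And>n. emeasure M {\<omega> \<in> space M. H < walk_gap X n \<omega>} < ennreal \<epsilon>"
proof -
  let ?\<mu> = "distr M borel (X 1)"
  have rv: "random_variable borel (X i)" if "1 \<le> i" for i
    using indep that by (auto simp: indep_vars_def)
  have rv1 [measurable]: "random_variable borel (X 1)" using rv by simp
  show ?thesis
  proof (cases "expectation (\<lambda>\<omega>. (X 1 \<omega>)\<^sup>2) = 0")
    case True
    have "AE \<omega> in M. X 1 \<omega> = 0"
      using integral_nonneg_eq_0_iff_AE[OF square] True by simp
    then have zero_law: "AE x in ?\<mu>. x = 0" using AE_distr_iff[OF rv1, of "\<lambda>x. x = 0"] by simp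
    have zero: "AE \<omega> in M. X i \<omega> = 0" if "1 \<le> i" for i
    proof -
      have "AE x in distr M borel (X i). x = 0" unfolding ident[OF that] by (rule zero_law)
      then show ?thesis using AE_distr_iff[OF rv[OF that], of "\<lambda>x. x = 0"] by simp
    qed
    have "AE \<omega> in M. \<forall>i\<in>{1..}. X i \<omega> = 0"
      using zero by (subst AE_ball_countable) auto
    then have small: "AE \<omega> in M. \<not> 1 < walk_gap X n \<omega>" for n
    proof (rule AE_mp, intro AE_I2 impI notI)
      fix \<omega> assume 0: "\<forall>i\<in>{1..}. X i \<omega> = 0" and gap: "1 < walk_gap X n \<omega>"
      have "random_walk X k \<omega> = 0" for k using 0 by (simp add: random_walk_def)
      then show False using gap largest_gap_endpoints[of 1 "\<lambda>k. random_walk X k \<omega>" n]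
        by (auto simp: walk_gap_def)
    qed
    show ?thesis
    proof (rule that[of 1])
      fix n
      have "emeasure M {\<omega> \<in> space M. 1 < walk_gap X n \<omega>} = 0"
        using small[of n] by (intro emeasure_eq_0_AE)
      then show "emeasure M {\<omega> \<in> space M. 1 < walk_gap X n \<omega>} < ennreal \<epsilon>" using \<epsilon> by simp
    qed simp
  next
    case False
    interpret law: centred_law ?\<mu>
    proof (intro centred_law.intro centred_law_axioms.intro)
      show "prob_space ?\<mu>" by (rule prob_space_distr) (rule rv1)
      show "integrable ?\<mu> (\<lambda>x. x\<^sup>2)" using square by (subst integrable_distr_eq[OF rv1]) simp_all
      show "(\<integral>x. x \<partial>?\<mu>) = 0" using centred by (subst integral_distr[OF rv1]) simp_all
      have "0 \<le> expectation (\<lambda>\<omega>. (X 1 \<omega>)\<^sup>2)" by simp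
      then have "0 < expectation (\<lambda>\<omega>. (X 1 \<omega>)\<^sup>2)" using False by linarith
      then show "0 < (\<integral>x. x\<^sup>2 \<partial>?\<mu>)" by (subst integral_distr[OF rv1]) simp_all
    qed simp
    obtain b K where bK: "0 < b" "b \<le> K" "0 < (\<integral>x. trunc_sq b x \<partial>?\<mu>)"
      "law.tail_moment b K \<le> (\<integral>x. trunc_sq b x \<partial>?\<mu>)"
      using law.obtain_scales by blast
    interpret avoiding_walk ?\<mu> b K by unfold_locales (fact bK)+
    obtain C where C: "0 \<le> C"
      "\<And>m y. \<bar>y\<bar> = K \<Longrightarrow> emeasure seq.S {\<omega>. avoids K m y \<omega>} \<le> ennreal (C / sqrt (real m + 1))"
      "\<And>H m y. K \<le> H \<Longrightarrow> \<bar>y\<bar> = K \<Longrightarrow>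
        emeasure seq.S {\<omega>. avoids K m y \<omega> \<and> jumps_across H ((m + 1) div 2) y \<omega>}
          \<le> ennreal (C * law.tail_moment b H / sqrt (real m + 1))"
      using two_sided_bounds by blast
    have "(\<lambda>N. 16 * C * (C * law.tail_moment b (real N))) \<longlonglongrightarrow> 16 * C * (C * 0)"
      by (intro tendsto_mult_left law.tail_moment_limit)
    then have "eventually (\<lambda>N. 16 * C * (C * law.tail_moment b (real N)) < \<epsilon>) sequentially"
      using \<epsilon> by (intro order_tendstoD(2)[where y = "16 * C * (C * 0)"]) auto
    moreover have "eventually (\<lambda>N. N \<ge> nat \<lceil>2 * K\<rceil>) sequentially" by (rule eventually_ge_at_top)
    ultimately have "eventually (\<lambda>N. 16 * C * (C * law.tail_moment b (real N)) < \<epsilon> \<and> N \<ge> nat \<lceil>2 * K\<rceil>) sequentially"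
      by (rule eventually_conj)
    then obtain N where N: "16 * C * (C * law.tail_moment b (real N)) < \<epsilon>" "nat \<lceil>2 * K\<rceil> \<le> N"
      by (auto simp: eventually_sequentially)
    have H: "2 * K \<le> real N" using N(2) by linarith
    then have KH: "K \<le> real N" using K_pos by linarith
    show ?thesis
    proof (rule that[of "real N"])
      fix n
      have "emeasure M {\<omega> \<in> space M. real N < walk_gap X n \<omega>} \<le> ennreal (16 * C * (C * law.tail_moment b (real N)))"
      proof (rule gap_tail_le[OF C(1) C(2) C(3)[OF KH] _ H])
        show "0 \<le> C * law.tail_moment b (real N)" using C(1) law.tail_moment_nonneg by simp
        show "distr M seq.S (\<lambda>\<omega> t. X (\<nu> t) \<omega>) = seq.S" if "inj \<nu>" "\<And>t. 1 \<le> \<nu> t" for \<nu>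
          by (rule distr_iid_sequence[OF indep ident that])
      qed (use rv in auto)
      also have "\<dots> < ennreal \<epsilon>" using N(1) \<epsilon> by (intro ennreal_lessI)
      finally show "emeasure M {\<omega> \<in> space M. real N < walk_gap X n \<omega>} < ennreal \<epsilon>" .
    qed simp
  qed
qed

theorem proposition1:
  fixes M :: "'a measure" and X :: "nat \<Rightarrow> 'a \<Rightarrow> real"
  assumes prob: "prob_space M"
    and indep: "prob_space.indep_vars M (\<lambda>_. borel) X {1..}"
    and ident: "\<And>i. i \<ge> 1 \<Longrightarrow> distr M borel (X i) = distr M borel (X 1)"
    and int: "integrable M (X 1)"
    and centred: "integral\<^sup>L M (X 1) = 0"
    and finite_variance: "integrable M (\<lambda>\<omega>. (X 1 \<omega> - integral\<^sup>L M (X 1))\<^sup>2)"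
  shows "tight (\<lambda>n. distr M borel (walk_gap X (Suc n)))"
proof -
  interpret prob_space M by (rule prob)
  have rv: "random_variable borel (X i)" if "1 \<le> i" for i
    using indep that by (auto simp: indep_vars_def)
  have gap_measurable [measurable]: "random_variable borel (walk_gap X n)" for n
    unfolding walk_gap_def[abs_def]
  proof (rule measurable_largest_gap)
    show "(\<lambda>\<omega>. random_walk X k \<omega>) \<in> borel_measurable M" for k
      unfolding random_walk_def using rv by (intro borel_measurable_sum) auto
  qed
  have square: "integrable M (\<lambda>\<omega>. (X 1 \<omega>)\<^sup>2)" using finite_variance centred by simp
  show ?thesis
    unfolding tight_def
  proof (intro conjI allI impI)
    show "real_distribution (distr M borel (walk_gap X (Suc n)))" for n
      by (rule real_distribution_distr) (rule gap_measurable)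
  next
    fix \<epsilon> :: real assume \<epsilon>: "0 < \<epsilon>"
    obtain H where H: "0 \<le> H" "\<And>n. emeasure M {\<omega> \<in> space M. H < walk_gap X n \<omega>} < ennreal \<epsilon>"
      using walk_gap_uniform_tail[OF indep ident centred square \<epsilon>] by blast
    have "1 - \<epsilon> < measure (distr M borel (walk_gap X (Suc n))) {-1<..H}" for n
    proof -
      let ?B = "{\<omega> \<in> space M. H < walk_gap X (Suc n) \<omega>}"
      have B: "?B \<in> sets M" by measurable
      have "prob ?B < \<epsilon>" using H(2)[of "Suc n"] by (simp add: emeasure_eq_measure ennreal_less_iff)
      moreover have "walk_gap X (Suc n) -` {-1<..H} \<inter> space M = space M - ?B"
      proof -
        have "- 1 < walk_gap X (Suc n) \<omega>" for \<omega>
        proof -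
          have "0 \<le> walk_gap X (Suc n) \<omega>" unfolding walk_gap_def by (rule largest_gap_nonneg)
          then show ?thesis by linarith
        qed
        then show ?thesis by auto
      qed
      then have "measure (distr M borel (walk_gap X (Suc n))) {-1<..H} = 1 - prob ?B"
        using prob_compl[OF B] by (simp add: measure_distr)
      ultimately show ?thesis by simp
    qed
    then show "\<exists>a b. a < b \<and> (\<forall>n. 1 - \<epsilon> < measure (distr M borel (walk_gap X (Suc n))) {a<..b})"
      using H(1) by (intro exI[of _ "-1"] exI[of _ H]) auto
  qed
qed

end
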